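(* Let $P$ be a pattern on three vertices. If $P$ is none of the four patterns \textsc{Triangle}, \textsc{Comparability}, co-\textsc{Triangle}, co-\textsc{Comparability}, then the $P$-Detection problem can be solved in linear time $O(n+m)$.
   Context: A pattern $P$ consists of a finite totally ordered vertex set $V(P)$ together with a partition of the set of unordered pairs of distinct vertices of $V(P)$ into three sets: $M(P)$ (mandatory edges), $F(P)$ (forbidden edges) and $U(P)$ (undecided pairs). An ordered graph $(G,\tau)$ is a finite simple undirected graph $G$ with a total order $\tau$ on $V(G)$. $(G,\tau)$ contains $P$ if there is a set $X\subseteq V(G)$ with $|X|=|V(P)|$ such that, identifying $X$ with $V(P)$ via the unique order-preserving bijection, every pair of $M(P)$ is an edge of $G$ and every pair of $F(P)$ is a non-edge of $G$ (undecided pairs are unconstrained); otherwise $(G,\tau)$ avoids $P$. For a fixed pattern $P$, the $P$-Detection problem takes as input an ordered graph $(G,\tau)$ with $n$ vertices and $m$ edges, $G$ given by adjacency lists, and asks whether $(G,\tau)$ contains $P$. The complement of a pattern exchanges $M(P)$ and $F(P)$. On vertices $1<2<3$: \textsc{Triangle} has all three pairs mandatory; \textsc{Comparability} has $(1,2),(2,3)$ mandatory and $(1,3)$ forbidden; co-\textsc{Triangle} and co-\textsc{Comparability} are their complements. *)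

theory Defs
  imports Main
begin

section \<open>Patterns and ordered graphs\<close>

definition all_pairs :: "'a set \<Rightarrow> 'a set set" where
  "all_pairs V = {e. e \<subseteq> V \<and> card e = 2}"

text \<open>Total orders are reflexive relations, as in \<^const>\<open>linear_order_on\<close>.\<close>

record 'p pattern =
  pverts :: "'p set"
  pord :: "('p \<times> 'p) set"
  mandatory :: "'p set set"
  forbidden :: "'p set set"
  undecided :: "'p set set"

definition is_pattern :: "'p pattern \<Rightarrow> bool" where
  "is_pattern P \<longleftrightarrow>
     finite (pverts P) \<and> linear_order_on (pverts P) (pord P) \<and>
     mandatory P \<union> forbidden P \<union> undecided P = all_pairs (pverts P) \<and>
     mandatory P \<inter> forbidden P = {} \<and>
     mandatory P \<inter> undecided P = {} \<and>
     forbidden P \<inter> undecided P = {}"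

record 'v ordered_graph =
  verts :: "'v set"
  edges :: "'v set set"
  vord :: "('v \<times> 'v) set"

definition is_ordered_graph :: "'v ordered_graph \<Rightarrow> bool" where
  "is_ordered_graph G \<longleftrightarrow>
     finite (verts G) \<and> edges G \<subseteq> all_pairs (verts G) \<and>
     linear_order_on (verts G) (vord G)"

definition order_bij ::
  "('a \<Rightarrow> 'b) \<Rightarrow> 'a set \<Rightarrow> ('a \<times> 'a) set \<Rightarrow> 'b set \<Rightarrow> ('b \<times> 'b) set \<Rightarrow> bool" where
  "order_bij f A r B s \<longleftrightarrow>
     bij_betw f A B \<and> (\<forall>x\<in>A. \<forall>y\<in>A. (x, y) \<in> r \<longleftrightarrow> (f x, f y) \<in> s)"

definition contains :: "'v ordered_graph \<Rightarrow> 'p pattern \<Rightarrow> bool" where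
  "contains G P \<longleftrightarrow>
     (\<exists>X f. X \<subseteq> verts G \<and> card X = card (pverts P) \<and>
        order_bij f (pverts P) (pord P) X (vord G) \<and>
        (\<forall>e\<in>mandatory P. f ` e \<in> edges G) \<and>
        (\<forall>e\<in>forbidden P. f ` e \<notin> edges G))"

definition pattern_iso :: "'p pattern \<Rightarrow> 'q pattern \<Rightarrow> bool" where
  "pattern_iso P Q \<longleftrightarrow>
     (\<exists>f. order_bij f (pverts P) (pord P) (pverts Q) (pord Q) \<and>
        (`) f ` mandatory P = mandatory Q \<and>
        (`) f ` forbidden P = forbidden Q \<and>
        (`) f ` undecided P = undecided Q)"

definition complement :: "'p pattern \<Rightarrow> 'p pattern" where
  "complement P = P\<lparr>mandatory := forbidden P, forbidden := mandatory P\<rparr>"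

definition Triangle :: "nat pattern" where
  "Triangle =
     \<lparr>pverts = {1, 2, 3}, pord = {(i, j). i \<in> {1, 2, 3} \<and> j \<in> {1, 2, 3} \<and> i \<le> j},
      mandatory = {{1, 2}, {2, 3}, {1, 3}}, forbidden = {}, undecided = {}\<rparr>"

definition Comparability :: "nat pattern" where
  "Comparability =
     \<lparr>pverts = {1, 2, 3}, pord = {(i, j). i \<in> {1, 2, 3} \<and> j \<in> {1, 2, 3} \<and> i \<le> j},
      mandatory = {{1, 2}, {2, 3}}, forbidden = {{1, 3}}, undecided = {}\<rparr>"

section \<open>Random access machines\<close>

text \<open>
  Running time is measured on a unit-cost word RAM with structured control flow. A program is a
  fixed finite object; it uses natural-number registers and arrays (both named by numbers), and
  its only arithmetic is addition and truncated subtraction. Each executed instruction or test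
  costs one time unit. Since a program names finitely many arrays, having several of them rather
  than one memory changes the running time by a constant factor only (interleave them).
\<close>

datatype operand = Const nat | Reg nat

datatype test = Less operand operand | Equal operand operand

datatype program =
    Skip
  | Move nat operand
  | Add nat operand operand
  | Sub nat operand operand
  | Load nat nat operand          \<comment> \<open>register, array, index\<close>
  | Store nat operand operand     \<comment> \<open>array, index, value\<close>
  | Seq program program
  | If test program program
  | While test program

record state =
  regs :: "nat \<Rightarrow> nat"
  arrs :: "nat \<Rightarrow> nat \<Rightarrow> nat"

fun val :: "state \<Rightarrow> operand \<Rightarrow> nat" where
  "val s (Const c) = c"
| "val s (Reg x) = regs s x"

fun holds :: "state \<Rightarrow> test \<Rightarrow> bool" where
  "holds s (Less a b) \<longleftrightarrow> val s a < val s b"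
| "holds s (Equal a b) \<longleftrightarrow> val s a = val s b"

definition set_reg :: "nat \<Rightarrow> nat \<Rightarrow> state \<Rightarrow> state" where
  "set_reg x v s = s\<lparr>regs := (regs s)(x := v)\<rparr>"

definition set_arr :: "nat \<Rightarrow> nat \<Rightarrow> nat \<Rightarrow> state \<Rightarrow> state" where
  "set_arr a i v s = s\<lparr>arrs := (arrs s)(a := (arrs s a)(i := v))\<rparr>"

text \<open>
  \<open>exec W c s t s'\<close>: started in \<open>s\<close>, program \<open>c\<close> halts after exactly \<open>t\<close> steps in \<open>s'\<close>.
  Words hold the numbers up to \<open>W\<close>. A run that writes a larger number, or uses one as an array
  index, is stuck: it has no result at all.
\<close>

inductive exec :: "nat \<Rightarrow> program \<Rightarrow> state \<Rightarrow> nat \<Rightarrow> state \<Rightarrow> bool" for W :: nat where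
  Skip: "exec W Skip s 1 s"
| Move: "val s a \<le> W \<Longrightarrow> exec W (Move x a) s 1 (set_reg x (val s a) s)"
| Add: "val s a + val s b \<le> W \<Longrightarrow> exec W (Add x a b) s 1 (set_reg x (val s a + val s b) s)"
| Sub: "val s a - val s b \<le> W \<Longrightarrow> exec W (Sub x a b) s 1 (set_reg x (val s a - val s b) s)"
| Load: "val s i \<le> W \<Longrightarrow> arrs s a (val s i) \<le> W \<Longrightarrow>
    exec W (Load x a i) s 1 (set_reg x (arrs s a (val s i)) s)"
| Store: "val s i \<le> W \<Longrightarrow> val s b \<le> W \<Longrightarrow>
    exec W (Store a i b) s 1 (set_arr a (val s i) (val s b) s)"
| Seq: "exec W c1 s t1 s1 \<Longrightarrow> exec W c2 s1 t2 s2 \<Longrightarrow> exec W (Seq c1 c2) s (t1 + t2) s2"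
| IfTrue: "holds s b \<Longrightarrow> exec W c1 s t s' \<Longrightarrow> exec W (If b c1 c2) s (t + 1) s'"
| IfFalse: "\<not> holds s b \<Longrightarrow> exec W c2 s t s' \<Longrightarrow> exec W (If b c1 c2) s (t + 1) s'"
| WhileFalse: "\<not> holds s b \<Longrightarrow> exec W (While b c) s 1 s"
| WhileTrue: "holds s b \<Longrightarrow> exec W c s t1 s1 \<Longrightarrow> exec W (While b c) s1 t2 s2 \<Longrightarrow>
    exec W (While b c) s (t1 + t2 + 1) s2"

lemma exec_deterministic:
  "exec W c s t s' \<Longrightarrow> exec W c s u s'' \<Longrightarrow> u = t \<and> s'' = s'"
proof (induction arbitrary: u s'' rule: exec.induct)
  case (Seq c1 s t1 s1 c2 t2 s2)
  from Seq.prems show ?case by cases (use Seq.IH in blast)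
next
  case (IfTrue s b c1 t s' c2)
  from IfTrue.prems show ?case by cases (use IfTrue in blast)+
next
  case (IfFalse s b c2 t s' c1)
  from IfFalse.prems show ?case by cases (use IfFalse in blast)+
next
  case (WhileTrue s b c t1 s1 t2 s2)
  from WhileTrue.prems show ?case by cases (use WhileTrue in blast)+
qed (auto elim: exec.cases)

section \<open>The detection problem\<close>

text \<open>
  The vertices of an input graph are named \<open>0, \<dots>, n - 1\<close>. It is given by its adjacency lists,
  each in arbitrary order, and by the list of its vertices in increasing order, which need not be
  the order of their names.
\<close>

definition represents :: "nat list \<Rightarrow> nat list list \<Rightarrow> nat ordered_graph \<Rightarrow> bool" where
  "represents vs adj G \<longleftrightarrow>
     verts G = {..<length adj} \<and>
     (\<forall>v<length adj. distinct (adj ! v) \<and> set (adj ! v) = {u. {v, u} \<in> edges G}) \<and>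
     distinct vs \<and> set vs = verts G \<and> sorted_wrt (\<lambda>u v. (u, v) \<in> vord G) vs"

text \<open>
  Memory layout: array 2 holds all adjacency lists consecutively, and the list of vertex \<open>v\<close>
  occupies the positions from \<open>offset adj v\<close> up to, but not including, \<open>offset adj (v + 1)\<close>.
\<close>

definition offset :: "nat list list \<Rightarrow> nat \<Rightarrow> nat" where
  "offset adj v = (\<Sum>u<v. length (adj ! u))"

definition array_of :: "nat list \<Rightarrow> nat \<Rightarrow> nat" where
  "array_of xs i = (if i < length xs then xs ! i else 0)"

definition input_state :: "nat list \<Rightarrow> nat list list \<Rightarrow> state" where
  "input_state vs adj =
     \<lparr>regs = (\<lambda>_. 0)(0 := length adj),
      arrs = (\<lambda>_ _. 0)
        (0 := array_of vs,
         1 := array_of (map (offset adj) [0..<length adj + 1]),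
         2 := array_of (concat adj))\<rparr>"

text \<open>
  One program must answer all inputs (in register 0) within \<open>a * (n + m + 1)\<close> steps, using words
  of \<open>O(log (n + m))\<close> bits. The summand 1 matters only for the empty graph.
\<close>

definition detection_in_linear_time :: "'p pattern \<Rightarrow> bool" where
  "detection_in_linear_time P \<longleftrightarrow>
     (\<exists>c a k. \<forall>G vs adj. is_ordered_graph G \<and> represents vs adj G \<longrightarrow>
        (let n = card (verts G); m = card (edges G) in
         \<exists>t s. exec ((n + m + 2) ^ k) c (input_state vs adj) t s \<and>
               t \<le> a * (n + m + 1) \<and>
               regs s 0 = (if contains G P then 1 else 0)))"

end

theory Submission
  imports Defs
begin

text \<open>
  Replace every vertex by its position in the order; reversing the order exchanges the pairs
  \<open>(1, 2)\<close> and \<open>(2, 3)\<close> of the pattern, so it is enough to treat each pattern or its mirror image.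

  If some pair is undecided, then the two other pairs share a vertex \<open>v\<close>, and whether \<open>v\<close> plays this
  role in some occurrence depends only on a few numbers obtained by one pass over the neighbours
  of \<open>v\<close>: the numbers of smaller and of larger neighbours, and the extreme ones.

  If no pair is undecided, the pattern is, up to mirroring, given by a Boolean \<open>b\<close>: the pairs
  \<open>(1, 3)\<close> and \<open>(2, 3)\<close> have adjacency \<open>b\<close> and the pair \<open>(1, 2)\<close> does not. As for perfect elimination
  orderings, it suffices to compare every \<open>z\<close> with its partner, the last \<open>y < z\<close> whose
  adjacency to \<open>z\<close> is \<open>b\<close>. Grouping the \<open>z\<close> by partner and marking the neighbours of \<open>y\<close> once, the
  comparison of \<open>z\<close> with \<open>y\<close> costs \<open>O(deg z)\<close> even for \<open>b = False\<close>: that some \<open>x < y\<close> is adjacent to \<open>y\<close>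
  but not to \<open>z\<close> is seen by counting the common neighbours below \<open>y\<close>.
\<close>

section \<open>Running times of programs\<close>

text \<open>A weakest precondition that also tracks time. It demands termination and excludes stuck
  runs; as \<open>exec\<close> is deterministic, the run it speaks of is the only one.\<close>

definition runs :: "nat \<Rightarrow> program \<Rightarrow> state \<Rightarrow> (nat \<Rightarrow> state \<Rightarrow> bool) \<Rightarrow> bool" where
  "runs W c s Q \<longleftrightarrow> (\<exists>t s'. exec W c s t s' \<and> Q t s')"

lemma runs_mono: "runs W c s Q \<Longrightarrow> (\<And>t s'. Q t s' \<Longrightarrow> Q' t s') \<Longrightarrow> runs W c s Q'"
  unfolding runs_def by blast

text \<open>As equivalences, this and the rules for the other loop-free constructs let
  \<open>simp\<close> execute straight-line code symbolically.\<close>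

lemma runs_Skip [simp]: "runs W Skip s Q \<longleftrightarrow> Q 1 s"
  unfolding runs_def One_nat_def by (auto elim: exec.cases intro: exec.intros[unfolded One_nat_def])

lemma runs_Move [simp]: "runs W (Move x a) s Q \<longleftrightarrow> val s a \<le> W \<and> Q 1 (set_reg x (val s a) s)"
  unfolding runs_def One_nat_def by (auto elim: exec.cases intro: exec.intros[unfolded One_nat_def])

lemma runs_Add [simp]:
  "runs W (Add x a b) s Q \<longleftrightarrow> val s a + val s b \<le> W \<and> Q 1 (set_reg x (val s a + val s b) s)"
  unfolding runs_def One_nat_def by (auto elim: exec.cases intro: exec.intros[unfolded One_nat_def])

lemma runs_Sub [simp]:
  "runs W (Sub x a b) s Q \<longleftrightarrow> val s a - val s b \<le> W \<and> Q 1 (set_reg x (val s a - val s b) s)"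
  unfolding runs_def One_nat_def by (auto elim: exec.cases intro: exec.intros[unfolded One_nat_def])

lemma runs_Load [simp]:
  "runs W (Load x a i) s Q \<longleftrightarrow>
     val s i \<le> W \<and> arrs s a (val s i) \<le> W \<and> Q 1 (set_reg x (arrs s a (val s i)) s)"
  unfolding runs_def One_nat_def by (auto elim: exec.cases intro: exec.intros[unfolded One_nat_def])

lemma runs_Store [simp]:
  "runs W (Store a i b) s Q \<longleftrightarrow>
     val s i \<le> W \<and> val s b \<le> W \<and> Q 1 (set_arr a (val s i) (val s b) s)"
  unfolding runs_def One_nat_def by (auto elim: exec.cases intro: exec.intros[unfolded One_nat_def])

lemma runs_Seq [simp]:
  "runs W (Seq c1 c2) s Q \<longleftrightarrow> runs W c1 s (\<lambda>t1 s1. runs W c2 s1 (\<lambda>t2. Q (t1 + t2)))"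
proof
  assume "runs W (Seq c1 c2) s Q"
  then obtain t s' where "exec W (Seq c1 c2) s t s'" "Q t s'"
    unfolding runs_def by blast
  then show "runs W c1 s (\<lambda>t1 s1. runs W c2 s1 (\<lambda>t2. Q (t1 + t2)))"
    unfolding runs_def by (auto elim!: exec.cases[of W "Seq c1 c2" s t s'])
qed (auto simp: runs_def intro: exec.Seq)

text \<open>Composes upper bounds on time through an intermediate assertion \<open>R\<close>,
  whereas \<open>runs_Seq\<close> keeps the times of both parts in the postcondition.\<close>

lemma runs_SeqI:
  assumes "runs W c1 s (\<lambda>t s'. t \<le> T1 \<and> R s')"
    and "\<And>s'. R s' \<Longrightarrow> runs W c2 s' (\<lambda>t s''. t \<le> T2 \<and> Q s'')"
    and "T1 + T2 \<le> T"
  shows "runs W (Seq c1 c2) s (\<lambda>t s'. t \<le> T \<and> Q s')"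
  unfolding runs_Seq using assms(1)
  by (rule runs_mono) (use assms(2,3) in \<open>auto elim!: runs_mono[OF assms(2)]\<close>)

lemma runs_If [simp]:
  "runs W (If b c1 c2) s Q \<longleftrightarrow>
     (if holds s b then runs W c1 s (\<lambda>t. Q (t + 1)) else runs W c2 s (\<lambda>t. Q (t + 1)))"
proof
  assume "runs W (If b c1 c2) s Q"
  then obtain t s' where "exec W (If b c1 c2) s t s'" "Q t s'"
    unfolding runs_def by blast
  then show "if holds s b then runs W c1 s (\<lambda>t. Q (t + 1)) else runs W c2 s (\<lambda>t. Q (t + 1))"
    unfolding runs_def by (auto elim!: exec.cases[of W "If b c1 c2" s t s']) blast+
next
  assume "if holds s b then runs W c1 s (\<lambda>t. Q (t + 1)) else runs W c2 s (\<lambda>t. Q (t + 1))"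
  then show "runs W (If b c1 c2) s Q"
    unfolding runs_def
    by (auto split: if_splits intro: exec.IfTrue[unfolded Suc_eq_plus1[symmetric]]
        exec.IfFalse[unfolded Suc_eq_plus1[symmetric]])
qed

lemma regs_set_reg [simp]: "regs (set_reg x v s) = (regs s)(x := v)"
  and arrs_set_reg [simp]: "arrs (set_reg x v s) = arrs s"
  and regs_set_arr [simp]: "regs (set_arr a i v s) = regs s"
  and arrs_set_arr [simp]: "arrs (set_arr a i v s) = (arrs s)(a := (arrs s a)(i := v))"
  by (simp_all add: set_reg_def set_arr_def)

lemmas exec_While = exec.WhileFalse[unfolded One_nat_def]
  exec.WhileTrue[unfolded One_nat_def add_Suc_right add_0_right]

text \<open>The function \<open>\<tau>\<close> is a potential: it bounds the time that the loop still takes.\<close>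

lemma runs_while:
  assumes "I s"
    and step: "\<And>s. I s \<Longrightarrow> holds s b \<Longrightarrow>
      runs W c s (\<lambda>t s'. I s' \<and> t + 1 + \<tau> s' \<le> (\<tau> s :: nat))"
    and exit: "\<And>s. I s \<Longrightarrow> \<not> holds s b \<Longrightarrow> 1 \<le> \<tau> s"
  shows "runs W (While b c) s (\<lambda>t s'. I s' \<and> \<not> holds s' b \<and> t \<le> \<tau> s)"
  using \<open>I s\<close>
proof (induction "\<tau> s" arbitrary: s rule: less_induct)
  case less
  show ?case
  proof (cases "holds s b")
    case True
    from step[OF less.prems True] obtain t1 s1 where 1: "exec W c s t1 s1" "I s1"
      and t1: "t1 + 1 + \<tau> s1 \<le> \<tau> s"
      unfolding runs_def by blast
    from less.hyps[of s1] 1 t1 obtain t2 s2 where "exec W (While b c) s1 t2 s2" "I s2"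
      "\<not> holds s2 b" "t2 \<le> \<tau> s1"
      unfolding runs_def by auto
    with 1 t1 True show ?thesis
      unfolding runs_def by (intro exI[of _ "t1 + t2 + 1"] exI[of _ s2]) (auto intro: exec_While)
  next
    case False
    with less.prems exit show ?thesis
      unfolding runs_def by (auto intro: exec_While)
  qed
qed

text \<open>The bound for a round may depend on \<open>k\<close>, so that a loop over all vertices
  costs a sum over degrees. Each round adds 1 for its test; the last summand 1 is the failing
  test.\<close>

lemma runs_for:
  assumes "I 0 s"
    and guard: "\<And>k s. I k s \<Longrightarrow> k \<le> n \<Longrightarrow> holds s b \<longleftrightarrow> k < n"
    and step: "\<And>k s. I k s \<Longrightarrow> k < n \<Longrightarrow> runs W c s (\<lambda>t s'. t \<le> f k \<and> I (Suc k) s')"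
  shows "runs W (While b c) s (\<lambda>t s'. t \<le> (\<Sum>k<n. f k + 1) + 1 \<and> I n s')"
proof -
  \<comment> \<open>Induction on the number \<open>j\<close> of rounds still to come.\<close>
  have "runs W (While b c) s (\<lambda>t s'. t \<le> (\<Sum>k=n-j..<n. f k + 1) + 1 \<and> I n s')"
    if "I (n - j) s" "j \<le> n" for j s
    using that
  proof (induction j arbitrary: s)
    case 0
    then have "exec W (While b c) s 1 s"
      using guard[of n s] by (auto intro: exec_While)
    then show ?case
      using 0 by (auto simp: runs_def)
  next
    case (Suc j)
    have h: "holds s b"
      using guard[OF Suc.prems(1)] Suc.prems(2) by auto
    have lt: "n - Suc j < n" and eq: "Suc (n - Suc j) = n - j"
      using Suc.prems(2) by auto
    from step[OF Suc.prems(1) lt] obtain t1 s1 where 1: "exec W c s t1 s1"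
      "t1 \<le> f (n - Suc j)" "I (n - j) s1"
      unfolding runs_def eq by auto
    from Suc.IH[OF 1(3)] Suc.prems(2) obtain t2 s2 where
      2: "exec W (While b c) s1 t2 s2" "t2 \<le> (\<Sum>k=n-j..<n. f k + 1) + 1" "I n s2"
      unfolding runs_def by auto
    have "(\<Sum>k=n-Suc j..<n. f k + 1) = f (n - Suc j) + 1 + (\<Sum>k=n-j..<n. f k + 1)"
      using lt by (subst sum.atLeast_Suc_lessThan) (simp_all only: eq)
    with 1 2 h show ?case
      unfolding runs_def
      by (intro exI[of _ "t1 + t2 + 1"] exI[of _ s2]) (auto intro: exec_While)
  qed
  from this[of n s] \<open>I 0 s\<close> show ?thesis
    by (simp add: atLeast0LessThan)
qed

text \<open>One more than the largest \<open>j < k\<close> satisfying the predicate, or 0 if there is none.\<close>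

fun latest :: "(nat \<Rightarrow> bool) \<Rightarrow> nat \<Rightarrow> nat" where
  "latest P 0 = 0"
| "latest P (Suc k) = (if P k then Suc k else latest P k)"

lemma latest_le: "latest P k \<le> k"
  by (induction k) auto

lemma latest_sat: "latest P k = Suc j \<Longrightarrow> P j"
  by (induction k) (auto split: if_splits)

lemma latest_above: "latest P k \<le> j \<Longrightarrow> j < k \<Longrightarrow> \<not> P j"
  by (induction k) (auto split: if_splits simp: less_Suc_eq)

text \<open>Used to recognise the value at which the skipping loop of \<open>anchor\<close>
  stops.\<close>

lemma latest_eqI:
  "r \<le> k \<Longrightarrow> (\<And>j. r = Suc j \<Longrightarrow> P j) \<Longrightarrow> (\<And>j. r \<le> j \<Longrightarrow> j < k \<Longrightarrow> \<not> P j) \<Longrightarrow> latest P k = r"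
  by (induction k) (auto simp: le_Suc_eq)

section \<open>Scanning the neighbours of a vertex\<close>

text \<open>The function \<open>p\<close> gives the position of a vertex.\<close>

locale adjacency_lists =
  fixes adj :: "nat list list" and p :: "nat \<Rightarrow> nat" and W :: nat
  assumes bij: "bij_betw p {..<length adj} {..<length adj}"
    and dist: "v < length adj \<Longrightarrow> distinct (adj ! v)"
    and nbr: "v < length adj \<Longrightarrow> u \<in> set (adj ! v) \<Longrightarrow> u < length adj \<and> v \<in> set (adj ! u) \<and> u \<noteq> v"
    and words: "offset adj (length adj) + 2 * length adj + 2 \<le> W"
begin

abbreviation "n \<equiv> length adj"
abbreviation "deg v \<equiv> length (adj ! v)"

definition e :: "nat \<Rightarrow> nat \<Rightarrow> bool" where
  "e i j \<longleftrightarrow> (\<exists>v<n. \<exists>u\<in>set (adj ! v). p v = i \<and> p u = j)"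

lemma p_less: "v < n \<Longrightarrow> p v < n"
  using bij by (auto simp: bij_betw_def)

lemma p_eq: "u < n \<Longrightarrow> v < n \<Longrightarrow> p u = p v \<longleftrightarrow> u = v"
  using bij by (auto simp: bij_betw_def inj_on_def)

lemma p_surj: "k < n \<Longrightarrow> \<exists>v<n. p v = k"
  using bij by (metis bij_betw_imp_surj_on imageE lessThan_iff)

lemma e_less: "e i j \<Longrightarrow> i < n \<and> j < n"
  unfolding e_def using nbr p_less by blast

lemma e_sym: "e i j \<Longrightarrow> e j i"
  unfolding e_def using nbr by blast

lemma e_irrefl: "\<not> e i i"
  unfolding e_def using nbr p_eq by metis

lemma e_p: "v < n \<Longrightarrow> e (p v) j \<longleftrightarrow> j \<in> p ` set (adj ! v)"
  unfolding e_def using p_eq by blast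

lemma offset_Suc: "offset adj (Suc v) = offset adj v + deg v"
  by (simp add: offset_def)

lemma offset_mono: "u \<le> v \<Longrightarrow> offset adj u \<le> offset adj v"
  by (auto simp: offset_def intro: sum_mono2)

lemma offset_le: "v < n \<Longrightarrow> offset adj v + deg v \<le> offset adj n"
  using offset_mono[of "Suc v" n] by (simp add: offset_Suc)

text \<open>The part of memory that stays fixed once the positions are computed; the vertex list in
  array 0 is read by \<open>rank\<close> alone.\<close>

definition mem :: "state \<Rightarrow> bool" where
  "mem s \<longleftrightarrow> regs s 0 = n \<and> (\<forall>v\<le>n. arrs s 1 v = offset adj v) \<and>
     (\<forall>v<n. \<forall>j<deg v. arrs s 2 (offset adj v + j) = adj ! v ! j) \<and>
     (\<forall>v<n. arrs s 3 v = p v)"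

lemma memD:
  assumes "mem s"
  shows "regs s 0 = n" "v \<le> n \<Longrightarrow> arrs s (Suc 0) v = offset adj v"
    "v < n \<Longrightarrow> j < deg v \<Longrightarrow> arrs s 2 (offset adj v + j) = adj ! v ! j"
    "v < n \<Longrightarrow> arrs s 3 v = p v"
  using assms by (auto simp: mem_def)

lemma mem_cong: "regs s' 0 = regs s 0 \<Longrightarrow> arrs s' 1 = arrs s 1 \<Longrightarrow> arrs s' 2 = arrs s 2 \<Longrightarrow>
    arrs s' 3 = arrs s 3 \<Longrightarrow> mem s' \<longleftrightarrow> mem s"
  by (simp add: mem_def)

lemma mem_set_reg [simp]: "0 < x \<Longrightarrow> mem (set_reg x v s) \<longleftrightarrow> mem s"
  by (rule mem_cong) auto

lemma mem_set_arr [simp]: "3 < a \<Longrightarrow> mem (set_arr a i v s) \<longleftrightarrow> mem s"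
  by (rule mem_cong) auto

end

abbreviation seq :: "program \<Rightarrow> program \<Rightarrow> program" (infixr ";;" 60) where
  "c1 ;; c2 \<equiv> Seq c1 c2"

text \<open>
  Arrays 3 to 6 hold the positions of the vertices, marks (indexed by position plus one),
  bucket heads (likewise), and links to the next vertex of the same bucket; the
  last two store vertices plus one, with 0 for none.
  Registers: 0 number of vertices, 1 current vertex, 2 and 3 index and end in array 2, 6 position
  of the current vertex, 7 and 8 numbers of smaller and larger neighbours, 9 minimum of the
  vertex and its neighbours, 10 largest smaller neighbour plus one, 11 number of neighbours
  smaller than the predecessor, 12 current mark, 13 answer. Using a new mark for each scan
  makes clearing array 4 unnecessary.
\<close>

definition scan_step :: program where
  "scan_step =
     Load 4 2 (Reg 2) ;; Load 4 3 (Reg 4) ;; Add 5 (Reg 4) (Const 1) ;; Store 4 (Reg 5) (Reg 12) ;;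
     If (Less (Reg 4) (Reg 6))
       (Add 7 (Reg 7) (Const 1) ;;
        If (Less (Reg 4) (Reg 9)) (Move 9 (Reg 4)) Skip ;;
        If (Less (Reg 10) (Reg 5)) (Move 10 (Reg 5)) Skip ;;
        If (Less (Reg 5) (Reg 6)) (Add 11 (Reg 11) (Const 1)) Skip)
       (Add 8 (Reg 8) (Const 1)) ;;
     Add 2 (Reg 2) (Const 1)"

definition scan :: program where
  "scan =
     Add 12 (Reg 12) (Const 1) ;; Load 6 3 (Reg 1) ;;
     Load 2 1 (Reg 1) ;; Add 3 (Reg 1) (Const 1) ;; Load 3 1 (Reg 3) ;;
     Move 7 (Const 0) ;; Move 8 (Const 0) ;; Move 9 (Reg 6) ;; Move 10 (Const 0) ;; Move 11 (Const 0) ;;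
     While (Less (Reg 2) (Reg 3)) scan_step"

context adjacency_lists begin

text \<open>The list \<open>ys\<close> holds the positions of the neighbours seen so far. As no
  entry of array 4 exceeds the current mark, the mark of the next scan, one larger, is
  fresh.\<close>

definition scan_inv :: "state \<Rightarrow> nat \<Rightarrow> nat list \<Rightarrow> state \<Rightarrow> bool" where
  "scan_inv s0 v ys s \<longleftrightarrow>
     (\<forall>x. x \<le> 1 \<or> 12 < x \<longrightarrow> regs s x = regs s0 x) \<and> (\<forall>a. a \<noteq> 4 \<longrightarrow> arrs s a = arrs s0 a) \<and>
     regs s 6 = p v \<and> regs s 12 = regs s0 12 + 1 \<and>
     regs s 7 = length (filter (\<lambda>q. q < p v) ys) \<and>
     regs s 8 = length (filter (\<lambda>q. \<not> q < p v) ys) \<and>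
     regs s 9 = Min (insert (p v) (set ys)) \<and>
     regs s 10 = Max (insert 0 (Suc ` {q \<in> set ys. q < p v})) \<and>
     regs s 11 = length (filter (\<lambda>q. Suc q < p v) ys) \<and>
     (\<forall>x. arrs s 4 x \<le> regs s 12) \<and>
     (\<forall>x. arrs s 4 x = regs s 12 \<longleftrightarrow> x \<in> Suc ` set ys)"

text \<open>Symbolic execution alone, with plain numbers in the registers; the invariant is treated
  separately.\<close>

lemma scan_step_effect:
  assumes "arrs s 2 (regs s 2) = u" "arrs s 3 u = q" "regs s 6 = k"
    "regs s 2 + 1 \<le> W" "u \<le> W" "q + 1 \<le> W" "regs s 12 \<le> W" "regs s 7 + 1 \<le> W"
    "regs s 8 + 1 \<le> W" "regs s 11 + 1 \<le> W"
  shows "runs W scan_step s (\<lambda>t s'. t \<le> 14 \<and>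
     (\<forall>x. x \<le> 1 \<or> 12 < x \<longrightarrow> regs s' x = regs s x) \<and>
     arrs s' = (arrs s)(4 := (arrs s 4)(Suc q := regs s 12)) \<and>
     regs s' 2 = regs s 2 + 1 \<and> regs s' 3 = regs s 3 \<and> regs s' 6 = k \<and> regs s' 12 = regs s 12 \<and>
     regs s' 7 = (if q < k then regs s 7 + 1 else regs s 7) \<and>
     regs s' 8 = (if q < k then regs s 8 else regs s 8 + 1) \<and>
     regs s' 9 = (if q < k then min q (regs s 9) else regs s 9) \<and>
     regs s' 10 = (if q < k then max (Suc q) (regs s 10) else regs s 10) \<and>
     regs s' 11 = (if Suc q < k then regs s 11 + 1 else regs s 11))"
  using assms unfolding scan_step_def by (auto simp: min_def max_def)

lemma scan_step_runs:
  assumes v: "v < n" "mem s0" "regs s0 12 < 2 * n" and j: "j < deg v"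
    and inv: "scan_inv s0 v (map p (take j (adj ! v))) s"
    and r: "regs s 2 = offset adj v + j" "regs s 3 = offset adj v + deg v"
  shows "runs W scan_step s (\<lambda>t s'. t \<le> 14 \<and> scan_inv s0 v (map p (take (Suc j) (adj ! v))) s' \<and>
    regs s' 2 = offset adj v + Suc j \<and> regs s' 3 = offset adj v + deg v)"
proof -
  define q where "q = p (adj ! v ! j)"
  define ys where "ys = map p (take j (adj ! v))"
  have ys': "map p (take (Suc j) (adj ! v)) = ys @ [q]"
    using j by (simp add: take_Suc_conv_app_nth ys_def q_def)
  have inv': "scan_inv s0 v ys s"
    using inv by (simp add: ys_def)
  then have m: "mem s"
    using \<open>mem s0\<close> by (subst mem_cong[of _ s0]) (auto simp: scan_inv_def)
  have u: "adj ! v ! j < n"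
    using nbr[OF v(1)] j by auto
  have q: "q < n"
    unfolding q_def using p_less u by auto
  have lens: "length (filter P ys) \<le> j" for P
    using length_filter_le[of P ys] j by (simp add: ys_def)
  note off = offset_le[OF v(1)]
  have I: "regs s 6 = p v" "regs s 12 = regs s0 12 + 1" "regs s 7 \<le> j" "regs s 8 \<le> j" "regs s 11 \<le> j"
    using inv' lens unfolding scan_inv_def by simp_all
  have S: "arrs s 2 (regs s 2) = adj ! v ! j" "arrs s 3 (adj ! v ! j) = q" "regs s 6 = p v"
    "regs s 2 + 1 \<le> W" "adj ! v ! j \<le> W" "q + 1 \<le> W" "regs s 12 \<le> W" "regs s 7 + 1 \<le> W"
    "regs s 8 + 1 \<le> W" "regs s 11 + 1 \<le> W"
    using memD(3)[OF m v(1) j] memD(4)[OF m u] off j words q v(3) u r I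
    by (simp_all add: q_def)
  \<comment> \<open>Only smaller neighbours update register 9: a larger one cannot change a minimum
    that is at most \<open>p v\<close>.\<close>
  have aux: "a = min q b \<Longrightarrow> b \<le> c \<Longrightarrow> a = (if q < c then min q b else b)" for a b c
    by auto
  have "Min (insert (p v) (set (ys @ [q]))) = min q (Min (insert (p v) (set ys)))"
    by (simp add: insert_commute[of "p v" q])
  moreover have "Min (insert (p v) (set ys)) \<le> p v"
    by simp
  ultimately have Min1: "Min (insert (p v) (set (ys @ [q]))) =
      (if q < p v then min q (Min (insert (p v) (set ys))) else Min (insert (p v) (set ys)))"
    by (rule aux)
  have *: "{x. (x = q \<or> x \<in> set ys) \<and> x < p v} =
      (if q < p v then insert q {x \<in> set ys. x < p v} else {x \<in> set ys. x < p v})"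
    by auto
  have "Max (insert 0 (insert (Suc q) (Suc ` {x \<in> set ys. x < p v}))) =
      max (Suc q) (Max (insert 0 (Suc ` {x \<in> set ys. x < p v})))"
    by (subst insert_commute, rule Max_insert) auto
  then have Max1: "Max (insert 0 (Suc ` {x. (x = q \<or> x \<in> set ys) \<and> x < p v})) =
     (if q < p v then max (Suc q) (Max (insert 0 (Suc ` {x \<in> set ys. x < p v})))
      else Max (insert 0 (Suc ` {x \<in> set ys. x < p v})))"
    unfolding * by (simp del: Max_insert)
  show ?thesis
    unfolding ys'
  proof (rule runs_mono[OF scan_step_effect[OF S]], elim conjE, intro conjI, goal_cases)
    case (2 t s')
    have "regs s' 9 = Min (insert (p v) (set (ys @ [q])))"
      using 2 inv' unfolding Min1 scan_inv_def by presburger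
    moreover have "regs s' 10 = Max (insert 0 (Suc ` {x \<in> set (ys @ [q]). x < p v}))"
      using 2 inv' by (simp add: scan_inv_def Max1 del: Max_insert)
    moreover have "arrs s' 4 x \<le> regs s' 12" "arrs s' 4 x = regs s' 12 \<longleftrightarrow> x \<in> Suc ` set (ys @ [q])" for x
      using 2 inv' by (auto simp: scan_inv_def)
    ultimately show ?case
      using 2 inv' unfolding scan_inv_def by (simp del: Min_insert Max_insert)
  qed (simp_all add: r)
qed

text \<open>The bound \<open>2 * n\<close> keeps the mark within the word size; it leaves room for
  two scans of every vertex, as in \<open>elimination_test\<close>.\<close>

lemma scan_runs:
  assumes v: "v < n" "mem s" "regs s 1 = v" "regs s 12 < 2 * n"
    and marks: "\<And>x. arrs s 4 x \<le> regs s 12"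
  shows "runs W scan s (\<lambda>t s'. t \<le> 15 * deg v + 12 \<and> scan_inv s v (map p (adj ! v)) s')"
proof -
  let ?I = "\<lambda>j s'. scan_inv s v (map p (take j (adj ! v))) s' \<and>
    regs s' 2 = offset adj v + j \<and> regs s' 3 = offset adj v + deg v"
  have loop: "runs W (While (Less (Reg 2) (Reg 3)) scan_step) s1
      (\<lambda>t s'. t \<le> (\<Sum>j<deg v. 14 + 1) + 1 \<and> ?I (deg v) s')" if "?I 0 s1" for s1
    by (rule runs_for[where I = ?I and f = "\<lambda>_. 14"])
      (use that scan_step_runs[OF v(1,2,4)] in auto)
  have m: "arrs s 3 v = p v" "arrs s (Suc 0) v = offset adj v"
    "arrs s (Suc 0) (Suc v) = offset adj v + deg v"
    using memD[OF v(2)] v(1) by (simp_all add: offset_Suc)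
  have b: "v \<le> W" "Suc v \<le> W" "p v \<le> W" "n \<le> W" "p v < n" "offset adj v \<le> W" "offset adj v + deg v \<le> W" "Suc (regs s 12) \<le> W"
    using v p_less[OF v(1)] words offset_le[OF v(1)] by auto
  \<comment> \<open>The incremented mark occurs nowhere in array 4, so the invariant starts with no
    marked position.\<close>
  have ne: "arrs s 4 x \<noteq> Suc (regs s 12)" "arrs s 4 x \<le> Suc (regs s 12)" for x
    using marks[of x] by auto
  show ?thesis
    unfolding scan_def
    apply (simp add: v(1,4) v(3)[simplified] m b)
    apply (rule runs_mono[OF loop])
    using v m b ne by (auto simp: scan_inv_def)
qed

end

section \<open>The two search programs\<close>

text \<open>
  Registers 14 to 16 receive the number of larger vertices, the number of smaller non-neighbours,
  and the number of vertices below the predecessor.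
\<close>

definition prepare_tests :: program where
  "prepare_tests =
     Sub 14 (Reg 0) (Reg 6) ;; Sub 14 (Reg 14) (Const 1) ;; Sub 15 (Reg 6) (Reg 7) ;;
     Sub 16 (Reg 6) (Const 1)"

definition examine :: "test \<Rightarrow> test \<Rightarrow> program" where
  "examine b1 b2 =
     scan ;; prepare_tests ;; If b1 (If b2 (Move 13 (Const 1)) Skip) Skip ;;
     Add 1 (Reg 1) (Const 1)"

definition star_search :: "test \<Rightarrow> test \<Rightarrow> program" where
  "star_search b1 b2 = Move 1 (Const 0) ;; While (Less (Reg 1) (Reg 0)) (examine b1 b2)"

text \<open>
  Register 20 receives the partner plus one. For \<open>b = False\<close> it is reached from the vertex by
  skipping marked positions, hence in time \<open>O(deg)\<close>; the loop stops at 0 because index 0 is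
  never marked.
\<close>

definition anchor :: "bool \<Rightarrow> program" where
  "anchor b =
     (if b then Move 20 (Reg 10)
      else Move 20 (Reg 6) ;; Load 21 4 (Reg 20) ;;
        While (Equal (Reg 21) (Reg 12)) (Sub 20 (Reg 20) (Const 1) ;; Load 21 4 (Reg 20)))"

definition file_vertex :: "bool \<Rightarrow> program" where
  "file_vertex b =
     scan ;; anchor b ;; Load 21 5 (Reg 20) ;; Store 6 (Reg 1) (Reg 21) ;;
     Add 1 (Reg 1) (Const 1) ;; Store 5 (Reg 20) (Reg 1)"

text \<open>Among the neighbours of the inspected vertex below the current one, register 19 counts
  all and register 18 those that are marked.\<close>

definition count_step :: program where
  "count_step =
     Load 4 2 (Reg 2) ;; Load 4 3 (Reg 4) ;;
     If (Less (Reg 4) (Reg 6))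
       (Add 19 (Reg 19) (Const 1) ;; Add 5 (Reg 4) (Const 1) ;; Load 5 4 (Reg 5) ;;
        If (Equal (Reg 5) (Reg 12)) (Add 18 (Reg 18) (Const 1)) Skip)
       Skip ;;
     Add 2 (Reg 2) (Const 1)"

text \<open>Register 17 walks through a bucket and holds a vertex plus one, with 0 at the end. The
  common neighbours in register 18 are compared with the lower neighbours of the inspected vertex if
  \<open>b\<close>, and with those of the bucket's own vertex (register 7) otherwise.\<close>

definition inspect :: "bool \<Rightarrow> program" where
  "inspect b =
     Sub 17 (Reg 17) (Const 1) ;; Load 2 1 (Reg 17) ;; Add 3 (Reg 17) (Const 1) ;;
     Load 3 1 (Reg 3) ;; Move 18 (Const 0) ;; Move 19 (Const 0) ;;
     While (Less (Reg 2) (Reg 3)) count_step ;;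
     If (Less (Reg 18) (Reg (if b then 19 else 7))) (Move 13 (Const 1)) Skip ;;
     Load 17 6 (Reg 17)"

definition process_bucket :: "bool \<Rightarrow> program" where
  "process_bucket b =
     scan ;; Add 20 (Reg 6) (Const 1) ;; Load 17 5 (Reg 20) ;;
     While (Less (Const 0) (Reg 17)) (inspect b) ;; Add 1 (Reg 1) (Const 1)"

definition elimination_test :: "bool \<Rightarrow> program" where
  "elimination_test b =
     Move 1 (Const 0) ;; While (Less (Reg 1) (Reg 0)) (file_vertex b) ;;
     Move 1 (Const 0) ;; While (Less (Reg 1) (Reg 0)) (process_bucket b)"

context adjacency_lists begin

section \<open>Neighbourhood statistics after a scan\<close>

definition stats :: "nat \<Rightarrow> state \<Rightarrow> bool" where
  "stats k s \<longleftrightarrow> regs s 0 = n \<and> regs s 6 = k \<and> regs s 7 = card {j. j < k \<and> e k j} \<and>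
     regs s 8 = card {j. k < j \<and> e k j} \<and> regs s 9 = Min (insert k {j. e k j}) \<and>
     regs s 10 = latest (e k) k \<and> regs s 11 = card {j. Suc j < k \<and> e k j}"

definition marked :: "nat \<Rightarrow> state \<Rightarrow> bool" where
  "marked k s \<longleftrightarrow> (\<forall>x. arrs s 4 x \<le> regs s 12) \<and>
     (\<forall>x. arrs s 4 x = regs s 12 \<longleftrightarrow> (\<exists>j. x = Suc j \<and> e k j))"

definition scanned :: "state \<Rightarrow> nat \<Rightarrow> state \<Rightarrow> bool" where
  "scanned s0 v s \<longleftrightarrow> mem s \<and> stats (p v) s \<and> marked (p v) s \<and> regs s 12 = regs s0 12 + 1 \<and>
     (\<forall>x. x \<le> 1 \<or> 12 < x \<longrightarrow> regs s x = regs s0 x) \<and> (\<forall>a. a \<noteq> 4 \<longrightarrow> arrs s a = arrs s0 a)"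

lemma set_map_p: "v < n \<Longrightarrow> set (map p (adj ! v)) = {j. e (p v) j}"
  using e_p by auto

lemma distinct_map_p: "v < n \<Longrightarrow> distinct (map p (adj ! v))"
  using dist[of v] nbr[of v] p_eq by (auto simp: distinct_map inj_on_def)

lemma length_filter_map_p:
  assumes "v < n"
  shows "length (filter P (map p (adj ! v))) = card {j. P j \<and> e (p v) j}"
proof -
  have "length (filter P (map p (adj ! v))) = card (set (filter P (map p (adj ! v))))"
    using distinct_map_p[OF assms] by (metis distinct_card distinct_filter)
  also have "set (filter P (map p (adj ! v))) = {j. P j \<and> e (p v) j}"
    unfolding set_filter set_map_p[OF assms] by auto
  finally show ?thesis .
qed

lemma card_e_le: "v < n \<Longrightarrow> card {j. P j \<and> e (p v) j} \<le> deg v"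
  by (subst length_filter_map_p[symmetric]) (auto intro: order_trans[OF length_filter_le])

lemma finite_e: "finite {j. P j \<and> e k j}" "finite {j. e k j}"
  by (rule finite_subset[of _ "{..<n}"]; use e_less in blast)+

text \<open>Adjacency lists are distinct, so lengths of filtered lists become cardinalities;
  irreflexivity of \<open>e\<close> turns the neighbours that are not smaller into the larger
  ones.\<close>

lemma scan_inv_scanned:
  assumes v: "v < n" "mem s0" and inv: "scan_inv s0 v (map p (adj ! v)) s"
  shows "scanned s0 v s"
proof -
  let ?k = "p v"
  have m: "mem s"
    using v inv by (subst mem_cong[of _ s0]) (auto simp: scan_inv_def)
  have "{j. \<not> j < ?k \<and> e ?k j} = {j. ?k < j \<and> e ?k j}"
    using e_irrefl by (auto simp: not_less nat_less_le)
  moreover have "Max (insert 0 (Suc ` {q. e ?k q \<and> q < ?k})) = latest (e ?k) ?k"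
  proof (rule Max_eqI)
    fix y assume y: "y \<in> insert 0 (Suc ` {q. e ?k q \<and> q < ?k})"
    show "y \<le> latest (e ?k) ?k"
    proof (cases y)
      case (Suc q)
      with y have "e ?k q" "q < ?k"
        by auto
      then show ?thesis
        using latest_above[of "e ?k" ?k q] Suc by force
    qed simp
  next
    show "latest (e ?k) ?k \<in> insert 0 (Suc ` {q. e ?k q \<and> q < ?k})"
      using latest_sat[of "e ?k" ?k] latest_le[of "e ?k" ?k] by (cases "latest (e ?k) ?k") auto
  qed (simp add: finite_e conj_commute[of "e _ _"])
  ultimately show ?thesis
    using inv m memD(1)[OF m] unfolding scanned_def scan_inv_def stats_def marked_def
      length_filter_map_p[OF v(1)] set_map_p[OF v(1)]
    by - (elim conjE, simp add: image_iff conj_commute del: Min_insert Max_insert)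
qed

definition ready :: "state \<Rightarrow> bool" where
  "ready s \<longleftrightarrow> mem s \<and> (\<forall>x. arrs s 4 x \<le> regs s 12)"

lemma scan_scanned:
  assumes "ready s" "regs s 1 = v" "v < n" "regs s 12 < 2 * n"
  shows "runs W scan s (\<lambda>t s'. t \<le> 15 * deg v + 12 \<and> scanned s v s')"
  using assms scan_inv_scanned[of v s]
  by (intro runs_mono[OF scan_runs[of v s]]) (auto simp: ready_def)

lemma ex_less_Suc: "(\<exists>i<Suc k. P i) \<longleftrightarrow> (\<exists>i<k. P i) \<or> P k"
  by (auto simp: less_Suc_eq)

text \<open>Reduces a search to the meaning \<open>T\<close> of its two tests at one position.
  Vertices are visited by name rather than by position, which yields the same answer because
  \<open>p\<close> is a bijection.\<close>

lemma star_search_runs: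
  assumes s: "ready s" "regs s 12 = 0" "regs s 13 = 0"
    and T: "\<And>k s. k < n \<Longrightarrow> stats k s \<Longrightarrow> regs s 14 = n - k - 1 \<Longrightarrow>
      regs s 15 = k - card {j. j < k \<and> e k j} \<Longrightarrow> regs s 16 = k - 1 \<Longrightarrow>
      holds s b1 \<and> holds s b2 \<longleftrightarrow> T k"
  shows "runs W (star_search b1 b2) s (\<lambda>t s'. t \<le> 15 * offset adj n + 30 * n + 2 \<and>
    regs s' 13 = of_bool (\<exists>k<n. T k))"
proof -
  let ?I = "\<lambda>v s. ready s \<and> regs s 1 = v \<and> regs s 12 = v \<and> regs s 13 = of_bool (\<exists>i<v. T (p i))"
  have loop: "runs W (While (Less (Reg 1) (Reg 0)) (examine b1 b2)) s1
      (\<lambda>t s'. t \<le> (\<Sum>v<n. (15 * deg v + 22) + 1) + 1 \<and> ?I n s')" if "?I 0 s1" for s1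
  proof (rule runs_for[where I = ?I])
    show "?I 0 s1"
      by (rule that)
  next
    fix v s assume "?I v s" "v \<le> n"
    then show "holds s (Less (Reg 1) (Reg 0)) \<longleftrightarrow> v < n"
      by (auto simp: ready_def mem_def)
  next
    fix v s assume I: "?I v s" and v: "v < n"
    have W: "n \<le> W" "1 \<le> W" "p v < n" "Suc v \<le> W"
      using words p_less[OF v] v by auto
    show "runs W (examine b1 b2) s (\<lambda>t s'. t \<le> 15 * deg v + 22 \<and> ?I (Suc v) s')"
      unfolding examine_def
    proof (rule runs_SeqI[OF scan_scanned[of s v]])
      fix s' assume sc: "scanned s v s'"
      define R where "R = (\<lambda>s2. ready s2 \<and> stats (p v) s2 \<and> regs s2 14 = n - p v - 1 \<and>
        regs s2 15 = p v - card {j. j < p v \<and> e (p v) j} \<and> regs s2 16 = p v - 1 \<and>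
        regs s2 1 = v \<and> regs s2 12 = Suc v \<and> regs s2 13 = of_bool (\<exists>i<v. T (p i)))"
      have st: "stats (p v) s'"
        using sc by (auto simp: scanned_def)
      then have r: "regs s' 0 = n" "regs s' 6 = p v"
        by (auto simp: stats_def)
      have prep: "runs W prepare_tests s' (\<lambda>t s2. t \<le> 4 \<and> R s2)"
      proof -
        have "n - p v \<le> W" "n - p v - 1 \<le> W" "p v - regs s' 7 \<le> W" "p v - 1 \<le> W"
          using W by auto
        moreover have "\<forall>x. arrs s' 4 x \<le> Suc v"
          using sc I unfolding scanned_def marked_def by - (elim conjE, simp)
        ultimately show ?thesis
          using sc I by (simp add: prepare_tests_def R_def r)
            (simp add: scanned_def stats_def ready_def)
      qed
      show "runs W (prepare_tests ;; If b1 (If b2 (Move 13 (Const 1)) Skip) Skip ;;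
          Add 1 (Reg 1) (Const 1)) s' (\<lambda>t s'. t \<le> 8 \<and> ?I (Suc v) s')"
      proof (rule runs_SeqI[OF prep])
        fix s2 assume R: "R s2"
        then have H: "holds s2 b1 \<and> holds s2 b2 \<longleftrightarrow> T (p v)"
          unfolding R_def using T[OF W(3)] by blast
        have "ready (set_reg (Suc 0) (Suc v) s2)" "ready (set_reg (Suc 0) (Suc v) (set_reg 13 (Suc 0) s2))"
          using R by (auto simp: ready_def R_def)
        then show "runs W (If b1 (If b2 (Move 13 (Const 1)) Skip) Skip ;; Add 1 (Reg 1) (Const 1)) s2
            (\<lambda>t s'. t \<le> 4 \<and> ?I (Suc v) s')"
          using H W(2,4) R unfolding R_def
          by (cases "T (p v)"; cases "\<exists>i<v. T (p i)"; simp add: ex_less_Suc)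
      qed simp
    qed (use I v in auto)
  qed
  have sum: "(\<Sum>v<n. (15 * deg v + 22) + 1) = 15 * offset adj n + 23 * n"
    by (simp add: sum.distrib sum_distrib_left offset_def)
  have ex: "(\<exists>v<n. T (p v)) \<longleftrightarrow> (\<exists>k<n. T k)"
    using p_surj p_less by blast
  have "?I 0 (set_reg 1 0 s)"
    using s by (auto simp: ready_def)
  from loop[OF this] show ?thesis
    unfolding star_search_def sum ex runs_Seq runs_Move
    by (intro conjI) (simp, rule runs_mono, simp, simp)
qed

section \<open>Partners, buckets and the elimination test\<close>

text \<open>Shifted by one, so that 0 stands for a vertex without partner.\<close>

definition partner :: "bool \<Rightarrow> nat \<Rightarrow> nat" where
  "partner b k = latest (\<lambda>j. e k j = b) k"

text \<open>
  Vertices are filed in increasing order at the front of their buckets, so the link of \<open>z\<close> leads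
  to the last earlier vertex with the same partner.
\<close>

definition chained :: "bool \<Rightarrow> nat \<Rightarrow> state \<Rightarrow> bool" where
  "chained b v s \<longleftrightarrow> (\<forall>y. arrs s 5 y = latest (\<lambda>z. partner b (p z) = y) v) \<and>
     (\<forall>z<v. arrs s 6 z = latest (\<lambda>x. partner b (p x) = partner b (p z)) z)"

text \<open>Phrased with the counts that \<open>inspect\<close> compares; \<open>bad_iff\<close>
  turns it into the existence of a witness below \<open>k\<close>.\<close>

definition bad :: "bool \<Rightarrow> nat \<Rightarrow> nat \<Rightarrow> bool" where
  "bad b k i \<longleftrightarrow> card {j. j < k \<and> e k j \<and> e i j} <
     (if b then card {j. j < k \<and> e i j} else card {j. j < k \<and> e k j})"

lemma partner_le: "partner b k \<le> k"
  by (simp add: partner_def latest_le)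

text \<open>For \<open>b = False\<close> every skipping step passes a smaller neighbour, so there
  are at most \<open>deg v\<close> of them. All skipped positions are adjacent to
  \<open>p v\<close>, hence the first unmarked one is the partner.\<close>

lemma anchor_runs:
  assumes s: "scanned s0 v s" and v: "v < n" and wordsize: "regs s 12 \<le> W"
  shows "runs W (anchor b) s (\<lambda>t s'. t \<le> 3 * deg v + 3 \<and>
    regs s' 20 = partner b (p v) \<and> arrs s' = arrs s \<and>
    (\<forall>x. x \<noteq> 20 \<and> x \<noteq> 21 \<longrightarrow> regs s' x = regs s x))"
proof -
  let ?k = "p v"
  have W: "n \<le> W" "?k < n"
    using words p_less[OF v] by auto
  have st: "regs s 6 = ?k" "regs s 10 = latest (e ?k) ?k"
    using s by (auto simp: scanned_def stats_def)
  have marks: "arrs s 4 x = regs s 12 \<longleftrightarrow> (\<exists>j. x = Suc j \<and> e ?k j)" for x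
    using s by (auto simp: scanned_def marked_def)
  show ?thesis
  proof (cases b)
    case True
    then show ?thesis
      using W st latest_le[of "e ?k" ?k] by (simp add: anchor_def partner_def)
  next
    case False
    define I where "I s1 \<longleftrightarrow> arrs s1 = arrs s \<and> (\<forall>x. x \<noteq> 20 \<and> x \<noteq> 21 \<longrightarrow> regs s1 x = regs s x) \<and>
      regs s1 20 \<le> ?k \<and> regs s1 21 = arrs s 4 (regs s1 20) \<and> (\<forall>j. regs s1 20 \<le> j \<and> j < ?k \<longrightarrow> e ?k j)"
      for s1 :: state
    \<comment> \<open>Three units for each smaller neighbour still ahead: test, subtraction and
      load.\<close>
    define \<tau> where "\<tau> s1 = 3 * card {j. j < regs s1 20 \<and> e ?k j} + 1" for s1 :: state
    have W4: "arrs s 4 x \<le> W" for x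
    proof -
      have "arrs s 4 x \<le> regs s 12"
        using s by (auto simp: scanned_def marked_def)
      then show ?thesis
        using wordsize by simp
    qed
    have loop: "runs W (While (Equal (Reg 21) (Reg 12)) (Sub 20 (Reg 20) (Const 1) ;; Load 21 4 (Reg 20))) s1
        (\<lambda>t s2. I s2 \<and> \<not> holds s2 (Equal (Reg 21) (Reg 12)) \<and> t \<le> \<tau> s1)" if "I s1" for s1
      using that
    proof (rule runs_while)
      fix s1 assume I: "I s1" and "holds s1 (Equal (Reg 21) (Reg 12))"
      then have "arrs s 4 (regs s1 20) = regs s 12"
        by (auto simp: I_def)
      then obtain y where y: "regs s1 20 = Suc y" "e ?k y"
        using marks by auto
      have "{j. j < Suc y \<and> e ?k j} = insert y {j. j < y \<and> e ?k j}"
        using y by auto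
      then have card: "card {j. j < Suc y \<and> e ?k j} = Suc (card {j. j < y \<and> e ?k j})"
        by simp
      have "I (set_reg 21 (arrs s 4 y) (set_reg 20 y s1))"
        using I y by (auto simp: I_def Suc_le_eq le_less) (metis Suc_lessI)
      then show "runs W (Sub 20 (Reg 20) (Const 1) ;; Load 21 4 (Reg 20)) s1
          (\<lambda>t s2. I s2 \<and> t + 1 + \<tau> s2 \<le> \<tau> s1)"
        using W W4 I y card by (auto simp: I_def \<tau>_def)
    qed (simp add: \<tau>_def)
    \<comment> \<open>Marks are indexed by position plus one, so for positive \<open>?k\<close> the
      index \<open>?k\<close> stands for position \<open>?k - 1\<close>, the largest
      candidate.\<close>
    have I0: "I (set_reg 21 (arrs s 4 ?k) (set_reg 20 ?k s))"
      by (auto simp: I_def)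
    have fin: "regs s2 20 = partner b ?k" if "I s2" "\<not> holds s2 (Equal (Reg 21) (Reg 12))" for s2
      unfolding partner_def using that False marks
      by (intro latest_eqI[symmetric]) (auto simp: I_def)
    have "card {j. j < ?k \<and> e ?k j} \<le> deg v"
      by (rule card_e_le[OF v])
    with W W4 I0 False show ?thesis
      unfolding anchor_def
      apply (simp add: st)
      apply (rule runs_mono[OF loop[OF I0, unfolded One_nat_def]])
      subgoal premises prems for t s'
      proof -
        have "regs s' 20 = partner False ?k"
          using fin[of s'] prems False by simp
        then show ?thesis
          using prems by (simp add: I_def \<tau>_def)
      qed
      done
  qed
qed

lemma file_vertex_runs:
  assumes "ready s" "chained b v s" "regs s 1 = v" "v < n" "regs s 12 < n"
  shows "runs W (file_vertex b) s (\<lambda>t s'. t \<le> 18 * deg v + 19 \<and> ready s' \<and> chained b (Suc v) s' \<and>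
    regs s' 1 = Suc v \<and> regs s' 12 = Suc (regs s 12) \<and> regs s' 13 = regs s 13)"
  unfolding file_vertex_def
proof (rule runs_SeqI[OF scan_scanned[of s v]])
  fix s1 assume sc: "scanned s v s1"
  let ?y = "partner b (p v)"
  have W: "Suc v \<le> W" "?y \<le> W"
    using words assms(4) p_less[OF assms(4)] partner_le[of b "p v"] by auto
  have c: "chained b v s1"
    using assms(2) sc by (auto simp: chained_def scanned_def)
  show "runs W (anchor b ;; Load 21 5 (Reg 20) ;; Store 6 (Reg 1) (Reg 21) ;;
      Add 1 (Reg 1) (Const 1) ;; Store 5 (Reg 20) (Reg 1)) s1 (\<lambda>t s'. t \<le> 3 * deg v + 7 \<and>
      ready s' \<and> chained b (Suc v) s' \<and>
      regs s' 1 = Suc v \<and> regs s' 12 = Suc (regs s 12) \<and> regs s' 13 = regs s 13)"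
  proof (rule runs_SeqI[OF anchor_runs[OF sc assms(4)], where ?T2.0 = 4])
    fix s2 :: state assume s2: "regs s2 20 = ?y \<and> arrs s2 = arrs s1 \<and>
      (\<forall>x. x \<noteq> 20 \<and> x \<noteq> 21 \<longrightarrow> regs s2 x = regs s1 x)"
    \<comment> \<open>The old head of the bucket becomes the link of \<open>v\<close>, and
      \<open>v\<close> plus one becomes the new head.\<close>
    have h: "arrs s1 5 ?y = latest (\<lambda>z. partner b (p z) = ?y) v"
      using c by (auto simp: chained_def)
    have h': "latest (\<lambda>z. partner b (p z) = ?y) v \<le> v"
      by (rule latest_le)
    have r: "regs s2 1 = v" "regs s2 12 = Suc (regs s 12)" "regs s2 13 = regs s 13"
      using s2 sc assms(3) by (auto simp: scanned_def)
    define s3 where "s3 = set_arr 5 ?y (Suc v) (set_reg 1 (Suc v) (set_arr 6 v (arrs s1 5 ?y)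
      (set_reg 21 (arrs s1 5 ?y) s2)))"
    have "mem s2"
      using sc s2 by (subst mem_cong[of _ s1]) (auto simp: scanned_def)
    moreover have "arrs s1 4 x \<le> regs s1 12" for x
      using sc by (auto simp: scanned_def marked_def)
    ultimately have "ready s3"
      using s2 by (auto simp: s3_def ready_def)
    moreover have "chained b (Suc v) s3"
      using c s2 by (auto simp: chained_def s3_def less_Suc_eq)
    ultimately show "runs W (Load 21 5 (Reg 20) ;; Store 6 (Reg 1) (Reg 21) ;;
      Add 1 (Reg 1) (Const 1) ;; Store 5 (Reg 20) (Reg 1)) s2 (\<lambda>t s'. t \<le> 4 \<and>
      ready s' \<and> chained b (Suc v) s' \<and>
      regs s' 1 = Suc v \<and> regs s' 12 = Suc (regs s 12) \<and> regs s' 13 = regs s 13)"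
      using W h h' s2 r by (simp add: s3_def)
  qed (use assms sc words in \<open>auto simp: scanned_def\<close>)
qed (use assms in auto)

text \<open>The list of \<open>z\<close> is traversed while the marks still describe adjacency to
  position \<open>k\<close>; hence one scan at \<open>k\<close> serves all vertices of its
  bucket.\<close>

lemma count_loop_runs:
  assumes z: "z < n" and k: "k < n" and m: "mem s" "marked k s" "regs s 6 = k"
    and r: "regs s 2 = offset adj z" "regs s 3 = offset adj z + deg z" "regs s 18 = 0" "regs s 19 = 0"
    and w: "regs s 12 \<le> W"
  shows "runs W (While (Less (Reg 2) (Reg 3)) count_step) s (\<lambda>t s'. t \<le> 10 * deg z + 1 \<and>
    arrs s' = arrs s \<and> (\<forall>x. x \<le> 1 \<or> 5 < x \<and> x < 18 \<or> 19 < x \<longrightarrow> regs s' x = regs s x) \<and>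
    regs s' 18 = card {j. j < k \<and> e k j \<and> e (p z) j} \<and> regs s' 19 = card {j. j < k \<and> e (p z) j})"
proof -
  define I where "I j s' \<longleftrightarrow> arrs s' = arrs s \<and>
    (\<forall>x. x \<le> 1 \<or> 5 < x \<and> x < 18 \<or> 19 < x \<longrightarrow> regs s' x = regs s x) \<and>
    regs s' 2 = offset adj z + j \<and> regs s' 3 = offset adj z + deg z \<and>
    regs s' 18 = length (filter (\<lambda>q. q < k \<and> e k q) (map p (take j (adj ! z)))) \<and>
    regs s' 19 = length (filter (\<lambda>q. q < k) (map p (take j (adj ! z))))" for j and s' :: state
  have "runs W (While (Less (Reg 2) (Reg 3)) count_step) s
      (\<lambda>t s'. t \<le> (\<Sum>j<deg z. 9 + 1) + 1 \<and> I (deg z) s')"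
  proof (rule runs_for[where I = I])
    show "I 0 s"
      using r by (simp add: I_def)
  next
    fix j s' assume "I j s'"
    then show "holds s' (Less (Reg 2) (Reg 3)) \<longleftrightarrow> j < deg z"
      by (simp add: I_def)
  next
    fix j s' assume I: "I j s'" and j: "j < deg z"
    define q where "q = p (adj ! z ! j)"
    define ys where "ys = map p (take j (adj ! z))"
    have ys': "map p (take (Suc j) (adj ! z)) = ys @ [q]"
      using j by (simp add: take_Suc_conv_app_nth ys_def q_def)
    have u: "adj ! z ! j < n"
      using nbr[OF z] j by auto
    have q: "q < n"
      unfolding q_def using p_less u by auto
    have lens: "length (filter P ys) \<le> j" for P
      using length_filter_le[of P ys] j by (simp add: ys_def)
    have "mem s'"
      using m I by (subst mem_cong[of _ s]) (auto simp: I_def)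
    then have a: "arrs s 2 (offset adj z + j) = adj ! z ! j" "arrs s 3 (adj ! z ! j) = q"
      using memD(3)[of s' z j] memD(4)[of s' "adj ! z ! j"] z j u I by (auto simp: I_def q_def)
    have marks: "arrs s 4 (Suc q) \<le> W" "arrs s 4 (Suc q) = regs s 12 \<longleftrightarrow> e k q"
      using m(2) w by (auto simp: marked_def intro: order_trans)
    have W: "offset adj z + j < W" "adj ! z ! j \<le> W" "q < W" "j < W"
      using offset_le[OF z] words j q u by auto
    have I': "arrs s' = arrs s" "\<And>x. x \<le> 1 \<or> 5 < x \<and> x < 18 \<or> 19 < x \<Longrightarrow> regs s' x = regs s x"
      "regs s' 2 = offset adj z + j" "regs s' 3 = offset adj z + deg z"
      "regs s' 18 = length (filter (\<lambda>q. q < k \<and> e k q) ys)" "regs s' 19 = length (filter (\<lambda>q. q < k) ys)"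
      using I by (auto simp: I_def ys_def)
    have l: "length (filter (\<lambda>q. q < k \<and> e k q) ys) < W" "length (filter (\<lambda>q. q < k) ys) < W"
      using lens W(4) le_less_trans by blast+
    show "runs W count_step s' (\<lambda>t s''. t \<le> 9 \<and> I (Suc j) s'')"
      unfolding I_def ys' count_step_def
      by (cases "q < k"; cases "e k q"; use W l marks in \<open>simp add: I' a m(3) Suc_le_eq\<close>)
  qed
  then show ?thesis
    by (rule runs_mono) (simp add: I_def length_filter_map_p[OF z, unfolded filter_map length_map] conj_assoc)
qed

lemma inspect_runs:
  assumes z: "z < n" and k: "k < n" and m: "mem s" "marked k s" "stats k s"
    and r: "regs s 17 = Suc z" "arrs s 6 z \<le> W" "regs s 12 \<le> W"
  shows "runs W (inspect b) s (\<lambda>t s'. t \<le> 10 * deg z + 10 \<and>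
    arrs s' = arrs s \<and> (\<forall>x. x \<le> 1 \<or> 5 < x \<and> x < 13 \<longrightarrow> regs s' x = regs s x) \<and>
    regs s' 17 = arrs s 6 z \<and> regs s' 13 = (if bad b k (p z) then 1 else regs s 13))"
proof -
  define R where "R s' \<longleftrightarrow>
    arrs s' = arrs s \<and> (\<forall>x. x \<le> 1 \<or> 5 < x \<and> x < 17 \<or> 19 < x \<longrightarrow> regs s' x = regs s x) \<and> regs s' 17 = z \<and>
    regs s' 18 = card {j. j < k \<and> e k j \<and> e (p z) j} \<and> regs s' 19 = card {j. j < k \<and> e (p z) j}"
    for s' :: state
  \<comment> \<open>The state before the loop, in the form in which \<open>simp\<close> produces it:
    register 3 holds first an index and then the offset loaded from there.\<close>
  define s1 where "s1 = set_reg 19 0 (set_reg 18 0 (set_reg 3 (offset adj z + deg z) (set_reg 3 (Suc z)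
     (set_reg 2 (offset adj z) (set_reg 17 z s)))))"
  have a: "arrs s (Suc 0) z = offset adj z" "arrs s (Suc 0) (Suc z) = offset adj z + deg z"
    using memD(2)[OF m(1)] z by (auto simp: offset_Suc)
  have W: "offset adj z + deg z \<le> W" "Suc z \<le> W" "1 \<le> W"
    using offset_le[OF z] words z by auto
  have s1: "mem s1" "marked k s1" "regs s1 6 = k" "regs s1 2 = offset adj z"
    "regs s1 3 = offset adj z + deg z" "regs s1 18 = 0" "regs s1 19 = 0" "regs s1 12 \<le> W"
    using m r(3) by (simp_all add: s1_def marked_def stats_def)
  have loop: "runs W (While (Less (Reg 2) (Reg 3)) count_step) s1 (\<lambda>t s'. t \<le> 10 * deg z + 1 \<and> R s')"
    by (rule runs_mono[OF count_loop_runs[OF z k s1]]) (auto simp: R_def s1_def)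
  have finish: "runs W (If (Less (Reg 18) (Reg (if b then 19 else 7))) (Move 13 (Const 1)) Skip ;; Load 17 6 (Reg 17)) s'
     (\<lambda>t s'. t \<le> 3 \<and> arrs s' = arrs s \<and> (\<forall>x. x \<le> 1 \<or> 5 < x \<and> x < 13 \<longrightarrow> regs s' x = regs s x) \<and>
    regs s' 17 = arrs s 6 z \<and> regs s' 13 = (if bad b k (p z) then 1 else regs s 13))" if "R s'" for s'
    using that W r m(3) unfolding R_def bad_def stats_def by (cases b) auto
  have rest: "runs W (While (Less (Reg 2) (Reg 3)) count_step ;;
      If (Less (Reg 18) (Reg (if b then 19 else 7))) (Move 13 (Const 1)) Skip ;; Load 17 6 (Reg 17)) s1
    (\<lambda>t s'. t \<le> 10 * deg z + 4 \<and> arrs s' = arrs s \<and> (\<forall>x. x \<le> 1 \<or> 5 < x \<and> x < 13 \<longrightarrow> regs s' x = regs s x) \<and>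
    regs s' 17 = arrs s 6 z \<and> regs s' 13 = (if bad b k (p z) then 1 else regs s 13))"
    by (rule runs_SeqI[OF loop finish]) auto
  have pre: "runs W (Sub 17 (Reg 17) (Const 1) ;; Load 2 1 (Reg 17) ;; Add 3 (Reg 17) (Const 1) ;;
     Load 3 1 (Reg 3) ;; Move 18 (Const 0) ;; Move 19 (Const 0) ;; c) s Q
      \<longleftrightarrow> runs W c s1 (\<lambda>t. Q (Suc (Suc (Suc (Suc (Suc (Suc t)))))))" for c Q
    using W a r by (simp add: s1_def)
  show ?thesis
    unfolding inspect_def pre by (rule runs_mono[OF rest]) simp
qed

text \<open>The potential of the walk through a bucket: links lead to smaller names, so the vertices
  still to come are below \<open>m\<close>. Each pays for \<open>inspect\<close> and one loop
  test.\<close>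

definition bucket_time :: "bool \<Rightarrow> nat \<Rightarrow> nat \<Rightarrow> nat" where
  "bucket_time b k m = (\<Sum>z<m. if partner b (p z) = Suc k then 10 * deg z + 11 else 0)"

lemma process_bucket_runs:
  assumes rd: "ready s" and ch: "chained b n s" and r: "regs s 1 = v" "v < n" "regs s 12 < 2 * n"
  shows "runs W (process_bucket b) s (\<lambda>t s'. t \<le> 15 * deg v + 16 + bucket_time b (p v) n \<and>
    ready s' \<and> chained b n s' \<and> regs s' 1 = Suc v \<and> regs s' 12 = Suc (regs s 12) \<and>
    regs s' 13 = (if \<exists>z<n. partner b (p z) = Suc (p v) \<and> bad b (p v) (p z) then 1 else regs s 13))"
  unfolding process_bucket_def
proof (rule runs_SeqI[OF scan_scanned[of s v], where ?T2.0 = "4 + bucket_time b (p v) n"])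
  fix s1 assume sc: "scanned s v s1"
  let ?k = "p v"
  let ?P = "\<lambda>z. partner b (p z) = Suc ?k"
  \<comment> \<open>A fixed point of \<open>latest ?P\<close> is 0 or one more than a member of the
    bucket. Register 13 accounts for the members from register 17 upwards.\<close>
  define I where "I s2 \<longleftrightarrow> arrs s2 = arrs s1 \<and> (\<forall>x. x \<le> 1 \<or> 5 < x \<and> x < 13 \<longrightarrow> regs s2 x = regs s1 x) \<and>
    regs s2 17 \<le> n \<and> latest ?P (regs s2 17) = regs s2 17 \<and>
    regs s2 13 = (if \<exists>z<n. regs s2 17 \<le> z \<and> ?P z \<and> bad b ?k (p z) then 1 else regs s 13)"
    for s2 :: state
  have k: "?k < n"
    using r p_less by auto
  have W: "Suc ?k \<le> W" "n \<le> W" "Suc v \<le> W" "regs s1 12 \<le> W"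
    using k words r sc by (auto simp: scanned_def)
  have sc': "mem s1" "marked ?k s1" "stats ?k s1" "regs s1 1 = v" "regs s1 12 = Suc (regs s 12)"
    "regs s1 13 = regs s 13"
    using sc r by (auto simp: scanned_def)
  have ch1: "chained b n s1"
    using sc ch by (auto simp: chained_def scanned_def)
  have loop: "runs W (While (Less (Const 0) (Reg 17)) (inspect b)) s2
      (\<lambda>t s'. I s' \<and> \<not> holds s' (Less (Const 0) (Reg 17)) \<and> t \<le> bucket_time b ?k (regs s2 17) + 1)"
    if "I s2" for s2
    using that
  proof (rule runs_while)
    fix s2 assume I: "I s2" and "holds s2 (Less (Const 0) (Reg 17))"
    then obtain z where z: "regs s2 17 = Suc z"
      by (cases "regs s2 17") auto
    have a: "arrs s2 = arrs s1" "\<And>x. x \<le> 1 \<or> 5 < x \<and> x < 13 \<Longrightarrow> regs s2 x = regs s1 x"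
      "regs s2 13 = (if \<exists>y<n. Suc z \<le> y \<and> ?P y \<and> bad b ?k (p y) then 1 else regs s 13)"
      using I z by (auto simp: I_def)
    have "regs s2 17 \<le> n" "latest ?P (regs s2 17) = regs s2 17"
      using I unfolding I_def by blast+
    then have zn: "z < n" and Pz: "?P z"
      using latest_sat[of ?P "Suc z" z] unfolding z by (simp_all only: Suc_le_eq)
    then have link: "arrs s1 6 z = latest ?P z"
      using ch1 by (simp add: chained_def)
    have fix_latest: "latest ?P (latest ?P z) = latest ?P z"
      by (cases "latest ?P z") (auto dest: latest_sat)
    have le: "latest ?P z \<le> z"
      by (rule latest_le)
    \<comment> \<open>No member of the bucket lies strictly between the vertex that the link leads
      to and \<open>z\<close>, so following the link misses none.\<close>
    have none: "\<not> ?P y" if "latest ?P z \<le> y" "y < z" for y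
      using latest_above[OF that] .
    have ex: "(\<exists>y<n. latest ?P z \<le> y \<and> ?P y \<and> bad b ?k (p y)) \<longleftrightarrow>
        bad b ?k (p z) \<or> (\<exists>y<n. Suc z \<le> y \<and> ?P y \<and> bad b ?k (p y))"
      (is "?L \<longleftrightarrow> ?R")
    proof
      assume ?L
      then obtain y where y: "y < n" "latest ?P z \<le> y" "?P y" "bad b ?k (p y)"
        by blast
      then have "z \<le> y"
        using none[of y] by (meson not_le)
      then show ?R
        using y by (cases "y = z") auto
    next
      assume ?R
      then show ?L
        using zn Pz le by (auto intro: order_trans)
    qed
    have time: "bucket_time b ?k (latest ?P z) \<le> bucket_time b ?k z"
      unfolding bucket_time_def using le by (intro sum_mono2) auto
    have m2: "mem s2" "marked ?k s2" "stats ?k s2"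
      using sc' a by (auto simp: marked_def stats_def mem_def)
    have suc: "bucket_time b ?k (Suc z) = bucket_time b ?k z + (10 * deg z + 11)"
      using Pz by (simp add: bucket_time_def)
    have ins: "runs W (inspect b) s2 (\<lambda>t s'. t \<le> 10 * deg z + 10 \<and>
      arrs s' = arrs s2 \<and> (\<forall>x. x \<le> 1 \<or> 5 < x \<and> x < 13 \<longrightarrow> regs s' x = regs s2 x) \<and>
      regs s' 17 = arrs s2 6 z \<and> regs s' 13 = (if bad b ?k (p z) then 1 else regs s2 13))"
      by (rule inspect_runs) (use zn k m2 z W a link le in auto)
    show "runs W (inspect b) s2
        (\<lambda>t s'. I s' \<and> t + 1 + (bucket_time b ?k (regs s' 17) + 1) \<le> bucket_time b ?k (regs s2 17) + 1)"
    proof (rule runs_mono[OF ins], elim conjE)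
      fix t :: nat and s' :: state
      assume t: "t \<le> 10 * deg z + 10" and s': "arrs s' = arrs s2" "regs s' 17 = arrs s2 6 z"
        "\<forall>x. x \<le> 1 \<or> 5 < x \<and> x < 13 \<longrightarrow> regs s' x = regs s2 x"
        "regs s' 13 = (if bad b ?k (p z) then 1 else regs s2 13)"
      have s17: "regs s' 17 = latest ?P z"
        using s' a link by simp
      have "regs s' 13 = (if \<exists>y<n. latest ?P z \<le> y \<and> ?P y \<and> bad b ?k (p y) then 1 else regs s 13)"
        unfolding ex s'(4) a(3) by (cases "bad b ?k (p z)") (simp_all only: simp_thms if_True if_False)
      then have "I s'"
        unfolding I_def s17 using s' a(1,2) le zn fix_latest by (simp del: latest.simps)
      then show "I s' \<and> t + 1 + (bucket_time b ?k (regs s' 17) + 1) \<le> bucket_time b ?k (regs s2 17) + 1"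
        using t time unfolding s17 z suc by simp
    qed
  qed auto
  define s2 where "s2 = set_reg 17 (latest ?P n) (set_reg 20 (Suc ?k) s1)"
  have hd: "arrs s1 5 (Suc ?k) = latest ?P n"
    using ch1 by (simp add: chained_def)
  have le: "latest ?P n \<le> n"
    by (rule latest_le)
  have "latest ?P (latest ?P n) = latest ?P n"
    by (cases "latest ?P n") (auto dest: latest_sat)
  moreover have "\<not> (\<exists>z<n. latest ?P n \<le> z \<and> ?P z \<and> bad b ?k (p z))"
    using latest_above by blast
  ultimately have I2: "I s2"
    using sc' le by (simp add: I_def s2_def) blast
  have tle: "bucket_time b ?k (regs s2 17) \<le> bucket_time b ?k n"
    unfolding bucket_time_def s2_def using le by (intro sum_mono2) auto
  have "runs W (While (Less (Const 0) (Reg 17)) (inspect b) ;; Add 1 (Reg 1) (Const 1)) s2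
    (\<lambda>t s'. t \<le> bucket_time b ?k n + 2 \<and>
    ready s' \<and> chained b n s' \<and> regs s' 1 = Suc v \<and> regs s' 12 = Suc (regs s 12) \<and>
    regs s' 13 = (if \<exists>z<n. ?P z \<and> bad b ?k (p z) then 1 else regs s 13))"
  proof (rule runs_SeqI[where ?T2.0 = 1])
    show "runs W (While (Less (Const 0) (Reg 17)) (inspect b)) s2
        (\<lambda>t s'. t \<le> bucket_time b ?k n + 1 \<and> (I s' \<and> regs s' 17 = 0))"
      by (rule runs_mono[OF loop[OF I2]]) (use tle in auto)
  next
    fix s3 assume s3: "I s3 \<and> regs s3 17 = 0"
    then have "ready (set_reg (Suc 0) (Suc v) s3)" "chained b n (set_reg (Suc 0) (Suc v) s3)"
      using sc' ch1 by (auto simp: I_def ready_def marked_def chained_def mem_def)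
    then show "runs W (Add 1 (Reg 1) (Const 1)) s3 (\<lambda>t s'. t \<le> 1 \<and>
      ready s' \<and> chained b n s' \<and> regs s' 1 = Suc v \<and> regs s' 12 = Suc (regs s 12) \<and>
      regs s' 13 = (if \<exists>z<n. ?P z \<and> bad b ?k (p z) then 1 else regs s 13))"
      using s3 W sc' by (simp add: I_def)
  qed simp
  then show "runs W (Add 20 (Reg 6) (Const 1) ;; Load 17 5 (Reg 20) ;;
     While (Less (Const 0) (Reg 17)) (inspect b) ;; Add 1 (Reg 1) (Const 1)) s1
    (\<lambda>t s'. t \<le> 4 + bucket_time b ?k n \<and>
    ready s' \<and> chained b n s' \<and> regs s' 1 = Suc v \<and> regs s' 12 = Suc (regs s 12) \<and>
    regs s' 13 = (if \<exists>z<n. ?P z \<and> bad b ?k (p z) then 1 else regs s 13))"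
    using W sc' hd le by (simp add: stats_def s2_def)
qed (use assms in auto)

text \<open>After exchanging the sums, each \<open>z\<close> contributes at most once, since
  \<open>p\<close> is injective and a vertex therefore lies in at most one processed bucket.\<close>

lemma sum_bucket_time: "(\<Sum>v<n. bucket_time b (p v) n) \<le> 10 * offset adj n + 11 * n"
proof -
  have "(\<Sum>v<n. bucket_time b (p v) n) =
      (\<Sum>z<n. \<Sum>v<n. if partner b (p z) = Suc (p v) then 10 * deg z + 11 else 0)"
    unfolding bucket_time_def by (rule sum.swap)
  also have "\<dots> \<le> (\<Sum>z<n. 10 * deg z + 11)"
  proof (rule sum_mono)
    fix z
    show "(\<Sum>v<n. if partner b (p z) = Suc (p v) then 10 * deg z + 11 else 0) \<le> 10 * deg z + 11"
    proof (cases "\<exists>w<n. partner b (p z) = Suc (p w)")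
      case True
      then obtain w where w: "w < n" "partner b (p z) = Suc (p w)"
        by blast
      then have "(\<Sum>v<n. if partner b (p z) = Suc (p v) then 10 * deg z + 11 else 0) =
          (\<Sum>v<n. if v = w then 10 * deg z + 11 else 0)"
        using p_eq by (intro sum.cong) auto
      then show ?thesis
        using w by simp
    qed (auto intro!: sum.neutral)
  qed
  also have "\<dots> = 10 * offset adj n + 11 * n"
    by (simp add: sum.distrib sum_distrib_left offset_def)
  finally show ?thesis .
qed

lemma ex_p: "(\<exists>v<n. Q (p v)) \<longleftrightarrow> (\<exists>k<n. Q k)"
  using p_surj p_less by blast

lemma elimination_test_runs:
  assumes s: "ready s" "regs s 12 = 0" "regs s 13 = 0" "arrs s 5 = (\<lambda>_. 0)"
  shows "runs W (elimination_test b) s (\<lambda>t s'. t \<le> 43 * offset adj n + 60 * n + 4 \<and>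
    regs s' 13 = of_bool (\<exists>k<n. \<exists>i<n. partner b i = Suc k \<and> bad b k i))"
proof -
  let ?I = "\<lambda>v s. ready s \<and> chained b v s \<and> regs s 1 = v \<and> regs s 12 = v \<and> regs s 13 = 0"
  \<comment> \<open>The second pass continues with the marks of the first, hence
    \<open>n + v\<close>.\<close>
  let ?J = "\<lambda>v s. ready s \<and> chained b n s \<and> regs s 1 = v \<and> regs s 12 = n + v \<and>
    regs s 13 = of_bool (\<exists>y<v. \<exists>z<n. partner b (p z) = Suc (p y) \<and> bad b (p y) (p z))"
  have loop1: "runs W (While (Less (Reg 1) (Reg 0)) (file_vertex b)) s1
      (\<lambda>t s'. t \<le> (\<Sum>v<n. (18 * deg v + 19) + 1) + 1 \<and> ?I n s')" if "?I 0 s1" for s1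
  proof (rule runs_for[where I = ?I])
    show "?I 0 s1"
      by (rule that)
  next
    fix v s assume "?I v s" "v \<le> n"
    then show "holds s (Less (Reg 1) (Reg 0)) \<longleftrightarrow> v < n"
      by (auto simp: ready_def mem_def)
  next
    fix v s assume "?I v s" "v < n"
    then show "runs W (file_vertex b) s (\<lambda>t s'. t \<le> 18 * deg v + 19 \<and> ?I (Suc v) s')"
      by (intro runs_mono[OF file_vertex_runs[of s b v]]) auto
  qed
  have loop2: "runs W (While (Less (Reg 1) (Reg 0)) (process_bucket b)) s1
      (\<lambda>t s'. t \<le> (\<Sum>v<n. (15 * deg v + 16 + bucket_time b (p v) n) + 1) + 1 \<and> ?J n s')"
    if "?J 0 s1" for s1
  proof (rule runs_for[where I = ?J])
    show "?J 0 s1"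
      by (rule that)
  next
    fix v s assume "?J v s" "v \<le> n"
    then show "holds s (Less (Reg 1) (Reg 0)) \<longleftrightarrow> v < n"
      by (auto simp: ready_def mem_def)
  next
    fix v s assume "?J v s" "v < n"
    then show "runs W (process_bucket b) s
        (\<lambda>t s'. t \<le> 15 * deg v + 16 + bucket_time b (p v) n \<and> ?J (Suc v) s')"
      by (intro runs_mono[OF process_bucket_runs[of s b v]]) (simp_all add: ex_less_Suc)
  qed
  have t1: "(\<Sum>v<n. (18 * deg v + 19) + 1) = 18 * offset adj n + 20 * n"
    by (simp add: sum.distrib sum_distrib_left offset_def)
  have "(\<Sum>v<n. (15 * deg v + 16 + bucket_time b (p v) n) + 1) =
      15 * offset adj n + 17 * n + (\<Sum>v<n. bucket_time b (p v) n)"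
    by (simp add: sum.distrib sum_distrib_left offset_def)
  then have t2: "(\<Sum>v<n. (15 * deg v + 16 + bucket_time b (p v) n) + 1) \<le> 25 * offset adj n + 28 * n"
    using sum_bucket_time[of b] by linarith
  have ex: "(\<exists>y<n. \<exists>z<n. partner b (p z) = Suc (p y) \<and> bad b (p y) (p z)) \<longleftrightarrow>
      (\<exists>k<n. \<exists>i<n. partner b i = Suc k \<and> bad b k i)"
    using ex_p[of "\<lambda>k. \<exists>z<n. partner b (p z) = Suc k \<and> bad b k (p z)"]
      ex_p[of "\<lambda>i. partner b i = Suc k \<and> bad b k i" for k] by simp
  have I0: "?I 0 (set_reg 1 0 s)"
    using s by (auto simp: ready_def chained_def)
  have J0: "?J 0 (set_reg 1 0 s1)" if "?I n s1" for s1
    using that by (auto simp: ready_def chained_def)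
  have part2: "runs W (Move 1 (Const 0) ;; While (Less (Reg 1) (Reg 0)) (process_bucket b)) s1
    (\<lambda>t s'. t \<le> 25 * offset adj n + 28 * n + 2 \<and> 
     regs s' 13 = of_bool (\<exists>k<n. \<exists>i<n. partner b i = Suc k \<and> bad b k i))" if "?I n s1" for s1
    unfolding runs_Seq runs_Move using t2
    by (intro conjI) (simp, rule runs_mono, unfold val.simps, rule loop2[OF J0[OF that]], simp add: ex)
  show ?thesis
    unfolding elimination_test_def
  proof (rule runs_SeqI[where ?T1.0 = 1 and R = "?I 0"])
    fix s1 assume "?I 0 s1"
    then show "runs W (While (Less (Reg 1) (Reg 0)) (file_vertex b) ;; Move 1 (Const 0) ;;
      While (Less (Reg 1) (Reg 0)) (process_bucket b)) s1
      (\<lambda>t s'. t \<le> 43 * offset adj n + 48 * n + 3 \<and>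
     regs s' 13 = of_bool (\<exists>k<n. \<exists>i<n. partner b i = Suc k \<and> bad b k i))"
      using t1 by (intro runs_SeqI[OF loop1 part2]) auto
  qed (use I0 in auto)
qed

end

section \<open>Correctness of the searches\<close>

datatype status = Mandatory | Forbidden | Undecided

fun meets :: "status \<Rightarrow> bool \<Rightarrow> bool" where
  "meets Mandatory b \<longleftrightarrow> b"
| "meets Forbidden b \<longleftrightarrow> \<not> b"
| "meets Undecided b \<longleftrightarrow> True"

text \<open>This is how a comparison of counters decides whether a non-neighbour exists.\<close>

lemma card_less_iff: "card {j. j < m \<and> P j} < m \<longleftrightarrow> (\<exists>j<m. \<not> P j)" for m :: nat
proof
  assume "card {j. j < m \<and> P j} < m"
  then have "{j. j < m \<and> P j} \<noteq> {..<m}"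
    by (metis card_lessThan nat_neq_iff)
  then show "\<exists>j<m. \<not> P j"
    by auto
next
  assume "\<exists>j<m. \<not> P j"
  then have "{j. j < m \<and> P j} \<subset> {..<m}"
    by auto
  then have "card {j. j < m \<and> P j} < card {..<m}"
    by (intro psubset_card_mono) auto
  then show "card {j. j < m \<and> P j} < m"
    by simp
qed

lemma one_less_card_iff:
  assumes "finite A"
  shows "1 < card A \<longleftrightarrow> (\<exists>x\<in>A. \<exists>y\<in>A. x < (y :: nat))"
proof -
  have "card A \<le> Suc 0 \<longleftrightarrow> (\<forall>x\<in>A. \<forall>y\<in>A. x = y)"
    using assms by (rule card_le_Suc0_iff_eq)
  then show ?thesis
    by (metis One_nat_def less_irrefl linorder_less_linear not_le)
qed

lemma card_complement: "m - card {j. j < m \<and> P j} = card {j. j < m \<and> \<not> P j}" for m :: nat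
proof -
  have "card ({..<m} - {j. j < m \<and> P j}) = card {..<m} - card {j. j < m \<and> P j}"
    by (rule card_Diff_subset) auto
  moreover have "{..<m} - {j. j < m \<and> P j} = {j. j < m \<and> \<not> P j}"
    by auto
  ultimately show ?thesis
    by simp
qed

definition always :: test where
  "always = Less (Const 0) (Const 1)"

definition left_test :: "status \<Rightarrow> test" where
  "left_test a = (case a of Mandatory \<Rightarrow> Less (Const 0) (Reg 7) | Forbidden \<Rightarrow> Less (Reg 7) (Reg 6)
     | Undecided \<Rightarrow> Less (Const 0) (Reg 6))"

definition right_test :: "status \<Rightarrow> test" where
  "right_test b = (case b of Mandatory \<Rightarrow> Less (Const 0) (Reg 8) | Forbidden \<Rightarrow> Less (Reg 8) (Reg 14)
     | Undecided \<Rightarrow> Less (Const 0) (Reg 14))"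

text \<open>For pairs of vertices below the current one: \<open>c\<close> is the adjacency required
  of the smaller vertex of the pair, \<open>b\<close> the status required of the larger.\<close>

definition pair_test :: "bool \<Rightarrow> status \<Rightarrow> test" where
  "pair_test c b =
     (if c then case b of Mandatory \<Rightarrow> Less (Const 1) (Reg 7) | Forbidden \<Rightarrow> Less (Reg 9) (Reg 15)
        | Undecided \<Rightarrow> Less (Reg 9) (Reg 16)
      else case b of Mandatory \<Rightarrow> Less (Reg 7) (Reg 10) | Forbidden \<Rightarrow> Less (Const 1) (Reg 15)
        | Undecided \<Rightarrow> Less (Reg 11) (Reg 16))"

section \<open>Correctness of the elimination test\<close>

context adjacency_lists begin

text \<open>The sets being counted are nested, so the counts differ exactly if the inclusion is
  proper.\<close>

lemma bad_iff: "bad b k i \<longleftrightarrow> (\<exists>x<k. e i x = b \<and> e k x \<noteq> b)"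
proof -
  have *: "card {j. j < k \<and> e u j \<and> e v j} < card {j. j < k \<and> e u j} \<longleftrightarrow>
      (\<exists>x<k. e u x \<and> \<not> e v x)" for u v
  proof
    assume "card {j. j < k \<and> e u j \<and> e v j} < card {j. j < k \<and> e u j}"
    then have "{j. j < k \<and> e u j \<and> e v j} \<noteq> {j. j < k \<and> e u j}"
      by (metis less_irrefl)
    then show "\<exists>x<k. e u x \<and> \<not> e v x"
      by auto
  next
    assume "\<exists>x<k. e u x \<and> \<not> e v x"
    then show "card {j. j < k \<and> e u j \<and> e v j} < card {j. j < k \<and> e u j}"
      by (intro psubset_card_mono) auto
  qed
  show ?thesis
    unfolding bad_def using *[of k i] *[of i k] by (cases b) (auto simp: conj_commute)
qed

lemma e_commute: "e i j = e j i"
  using e_sym by blast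

text \<open>
  From an occurrence \<open>x, y, z\<close> that the test at \<open>z\<close> misses, the partner \<open>k\<close> of \<open>z\<close> yields the
  occurrence \<open>x, y, k\<close> with \<open>k < z\<close>.
\<close>

lemma elimination_test_correct:
  "(\<exists>k<n. \<exists>i<n. partner b i = Suc k \<and> bad b k i) \<longleftrightarrow>
   (\<exists>x y z. x < y \<and> y < z \<and> z < n \<and> e x y \<noteq> b \<and> e y z = b \<and> e x z = b)"
proof
  assume "\<exists>k<n. \<exists>i<n. partner b i = Suc k \<and> bad b k i"
  then obtain k i x where *: "i < n" "partner b i = Suc k" "x < k" "e i x = b" "e k x \<noteq> b"
    unfolding bad_iff by blast
  have "e i k = b" "k < i"
    using latest_sat[of "\<lambda>j. e i j = b" i k] partner_le[of b i] *(2) unfolding partner_def by auto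
  then show "\<exists>x y z. x < y \<and> y < z \<and> z < n \<and> e x y \<noteq> b \<and> e y z = b \<and> e x z = b"
    using * e_commute[of i] e_commute[of x k] by blast
next
  assume "\<exists>x y z. x < y \<and> y < z \<and> z < n \<and> e x y \<noteq> b \<and> e y z = b \<and> e x z = b"
  then obtain x y z where "x < y" "y < z" "z < n" "e x y \<noteq> b" "e y z = b" "e x z = b"
    by blast
  then show "\<exists>k<n. \<exists>i<n. partner b i = Suc k \<and> bad b k i"
  proof (induction z arbitrary: x y rule: less_induct)
    case (less z)
    have s: "e z y = b" "e z x = b" "e y x \<noteq> b"
      using less.prems e_sym by blast+
    \<comment> \<open>Position \<open>y\<close> is itself a candidate for the partner of
      \<open>z\<close>, and the partner is the last one.\<close>
    have "\<not> partner b z \<le> y"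
      unfolding partner_def using latest_above[of "\<lambda>j. e z j = b" z y] s less.prems by blast
    then obtain k where k: "partner b z = Suc k" "y \<le> k"
      by (cases "partner b z") auto
    have kz: "k < z"
      using partner_le[of b z] k by simp
    show ?case
    proof (cases "\<exists>x<k. e z x = b \<and> e k x \<noteq> b")
      case True
      then show ?thesis
        using k kz less.prems(3) bad_iff by (intro exI[of _ k] exI[of _ z] conjI) auto
    next
      case False
      have "x < k"
        using k less.prems by simp
      \<comment> \<open>If the partner were \<open>y\<close>, then \<open>x\<close> would be a
        witness against it.\<close>
      moreover have "y \<noteq> k"
        using False s less.prems(1) by blast
      ultimately have "x < k" "y < k"
        using k by auto
      then have "e k x = b" "e k y = b"
        using False s by blast+
      then show ?thesis
        using less.IH[OF kz less.prems(1) \<open>y < k\<close>] kz less.prems(3,4) e_commute[of k] by simp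
    qed
  qed
qed

section \<open>Correctness of the searches at a single vertex\<close>

lemma left_test_holds:
  assumes "stats k s" "k < n"
  shows "holds s (left_test a) \<longleftrightarrow> (\<exists>x<k. meets a (e x k))"
proof -
  have "0 < card {j. j < k \<and> e k j} \<longleftrightarrow> (\<exists>x<k. e k x)"
    by (auto simp: card_gt_0_iff)
  moreover have "e x k = e k x" for x
    using e_sym by blast
  ultimately show ?thesis
    using assms(1) card_less_iff[of k "e k"]
    by (cases a) (auto simp: left_test_def stats_def)
qed

lemma right_test_holds:
  assumes "stats k s" "k < n" "regs s 14 = n - k - 1"
  shows "holds s (right_test b) \<longleftrightarrow> (\<exists>z. k < z \<and> z < n \<and> meets b (e k z))"
proof -
  \<comment> \<open>Shifting the positions above \<open>k\<close> down to 0 makes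
    \<open>card_less_iff\<close> applicable.\<close>
  have "{j. k < j \<and> e k j} = (\<lambda>i. k + 1 + i) ` {i. i < n - k - 1 \<and> e k (k + 1 + i)}"
  proof (intro set_eqI iffI)
    fix j assume "j \<in> {j. k < j \<and> e k j}"
    then show "j \<in> (\<lambda>i. k + 1 + i) ` {i. i < n - k - 1 \<and> e k (k + 1 + i)}"
      using e_less[of k j] by (intro image_eqI[of _ _ "j - k - 1"]) auto
  qed auto
  then have "card {j. k < j \<and> e k j} = card {i. i < n - k - 1 \<and> e k (k + 1 + i)}"
    by (simp only:) (rule card_image, simp add: inj_on_def)
  then have "card {j. k < j \<and> e k j} < n - k - 1 \<longleftrightarrow> (\<exists>i<n-k-1. \<not> e k (k + 1 + i))"
    by (simp only: card_less_iff)
  also have "\<dots> \<longleftrightarrow> (\<exists>z. k < z \<and> z < n \<and> \<not> e k z)" (is "?L \<longleftrightarrow> ?R")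
  proof
    assume ?L
    then obtain i where "i < n - k - 1" "\<not> e k (k + 1 + i)"
      by blast
    then show ?R
      by (intro exI[of _ "k + 1 + i"]) auto
  next
    assume ?R
    then obtain z where "k < z" "z < n" "\<not> e k z"
      by blast
    then show ?L
      by (intro exI[of _ "z - k - 1"]) auto
  qed
  finally have F: "card {j. k < j \<and> e k j} < n - k - 1 \<longleftrightarrow> (\<exists>z. k < z \<and> z < n \<and> \<not> e k z)" .
  have M: "0 < card {j. k < j \<and> e k j} \<longleftrightarrow> (\<exists>z. k < z \<and> z < n \<and> e k z)"
    using finite_e(1)[of "\<lambda>j. k < j" k] e_less by (auto simp: card_gt_0_iff)
  have U: "0 < n - k - 1 \<longleftrightarrow> (\<exists>z. k < z \<and> z < n)"
    by (auto intro: exI[of _ "Suc k"])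
  show ?thesis
    using assms(1,3) F M U by (cases b) (auto simp: right_test_def stats_def)
qed

lemma pair_test_holds:
  assumes "stats k s" "k < n" "regs s 15 = k - card {j. j < k \<and> e k j}" "regs s 16 = k - 1"
  shows "holds s (pair_test c b) \<longleftrightarrow> (\<exists>x y. x < y \<and> y < k \<and> e x k = c \<and> meets b (e y k))"
proof -
  have r: "regs s 7 = card {j. j < k \<and> e k j}" "regs s 9 = Min (insert k {j. e k j})"
    "regs s 10 = latest (e k) k" "regs s 11 = card {j. Suc j < k \<and> e k j}"
    "regs s 15 = card {j. j < k \<and> \<not> e k j}"
    using assms card_complement[of k "e k"] by (simp_all add: stats_def)
  \<comment> \<open>The vertex itself is the default: if no neighbour is smaller, then
    \<open>m = k\<close> and both comparisons with register 9 fail.\<close>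
  define m where "m = Min (insert k {j. e k j})"
  have me: "e k m" if "m < k"
    using Min_in[of "insert k {j. e k j}"] finite_e(2)[of k] that unfolding m_def by auto
  have ml: "m \<le> j" if "e k j" for j
    unfolding m_def using finite_e(2)[of k] that by simp
  consider (MM) "c" "b = Mandatory" | (MF) "c" "b = Forbidden" | (MU) "c" "b = Undecided"
    | (FM) "\<not> c" "b = Mandatory" | (FF) "\<not> c" "b = Forbidden" | (FU) "\<not> c" "b = Undecided"
    by (cases c; cases b) auto
  then have "holds s (pair_test c b) \<longleftrightarrow> (\<exists>x y. x < y \<and> y < k \<and> e k x = c \<and> meets b (e k y))"
  proof cases
    case MM
    have "1 < card {j. j < k \<and> e k j} \<longleftrightarrow> (\<exists>x y. x < y \<and> y < k \<and> e k x \<and> e k y)"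
      by (subst one_less_card_iff) (simp, use less_trans in blast)
    then show ?thesis
      using MM by (simp add: pair_test_def r)
  next
    case FF
    have "1 < card {j. j < k \<and> \<not> e k j} \<longleftrightarrow> (\<exists>x y. x < y \<and> y < k \<and> \<not> e k x \<and> \<not> e k y)"
      by (subst one_less_card_iff) (simp, use less_trans in blast)
    then show ?thesis
      using FF by (simp add: pair_test_def r)
  next
    case MU
    \<comment> \<open>If any pair serves, so does \<open>m\<close> with \<open>k - 1\<close>,
      because \<open>m\<close> is the smallest neighbour.\<close>
    have "m < k - 1 \<longleftrightarrow> (\<exists>x y. x < y \<and> y < k \<and> e k x)"
    proof
      assume "m < k - 1"
      then show "\<exists>x y. x < y \<and> y < k \<and> e k x"
        using me by (intro exI[of _ m] exI[of _ "k - 1"]) auto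
    next
      assume "\<exists>x y. x < y \<and> y < k \<and> e k x"
      then obtain x y where "x < y" "y < k" "e k x"
        by blast
      then show "m < k - 1"
        using ml[of x] by simp
    qed
    then show ?thesis
      using MU assms(4) by (simp add: pair_test_def r m_def)
  next
    case FU
    \<comment> \<open>Only positions below \<open>k - 1\<close> count for \<open>x\<close>, so that
      \<open>k - 1\<close> remains for \<open>y\<close>.\<close>
    have "{j. Suc j < k \<and> e k j} = {j. j < k - 1 \<and> e k j}"
      by auto
    then have "card {j. Suc j < k \<and> e k j} < k - 1 \<longleftrightarrow> (\<exists>x<k - 1. \<not> e k x)"
      using card_less_iff by simp
    also have "\<dots> \<longleftrightarrow> (\<exists>x y. x < y \<and> y < k \<and> \<not> e k x)"
    proof
      assume "\<exists>x<k - 1. \<not> e k x"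
      then obtain x where "x < k - 1" "\<not> e k x"
        by blast
      then show "\<exists>x y. x < y \<and> y < k \<and> \<not> e k x"
        by (intro exI[of _ x] exI[of _ "k - 1"]) auto
    next
      assume "\<exists>x y. x < y \<and> y < k \<and> \<not> e k x"
      then obtain x y where "x < y" "y < k" "\<not> e k x"
        by blast
      then show "\<exists>x<k - 1. \<not> e k x"
        by (intro exI[of _ x]) auto
    qed
    finally show ?thesis
      using FU assms(4) by (simp add: pair_test_def r)
  next
    case FM
    \<comment> \<open>One more than the largest smaller neighbour: all smaller neighbours lie below
      \<open>?r\<close>, so a non-neighbour precedes the last of them exactly if they do not fill
      all of these positions.\<close>
    let ?r = "latest (e k) k"
    have "{j. j < k \<and> e k j} = {j. j < ?r \<and> e k j}"
      using latest_above[of "e k" k] latest_le[of "e k" k]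
      by (intro Collect_cong) (meson not_le less_le_trans)
    then have "card {j. j < k \<and> e k j} < ?r \<longleftrightarrow> (\<exists>x<?r. \<not> e k x)"
      using card_less_iff by simp
    also have "\<dots> \<longleftrightarrow> (\<exists>x y. x < y \<and> y < k \<and> \<not> e k x \<and> e k y)"
    proof
      assume "\<exists>x<?r. \<not> e k x"
      then obtain x where x: "x < ?r" "\<not> e k x"
        by blast
      then obtain y where y: "?r = Suc y"
        by (cases ?r) auto
      then have "e k y" "y < k"
        using latest_sat[of "e k" k y] latest_le[of "e k" k] by auto
      then show "\<exists>x y. x < y \<and> y < k \<and> \<not> e k x \<and> e k y"
        using x y by (intro exI[of _ x] exI[of _ y]) (auto simp: less_Suc_eq)
    next
      assume "\<exists>x y. x < y \<and> y < k \<and> \<not> e k x \<and> e k y"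
      then obtain x y where "x < y" "y < k" "\<not> e k x" "e k y"
        by blast
      then show "\<exists>x<?r. \<not> e k x"
        using latest_above[of "e k" k y] by (intro exI[of _ x]) (meson not_le less_trans)
    qed
    finally show ?thesis
      using FM by (simp add: pair_test_def r)
  next
    case MF
    \<comment> \<open>The \<open>m\<close> positions below \<open>m\<close> are all non-neighbours,
      so another non-neighbour follows exactly if there are more than \<open>m\<close> in
      total.\<close>
    have "m < card {j. j < k \<and> \<not> e k j} \<longleftrightarrow> (\<exists>x y. x < y \<and> y < k \<and> e k x \<and> \<not> e k y)"
    proof
      assume *: "m < card {j. j < k \<and> \<not> e k j}"
      have "\<not> {j. j < k \<and> \<not> e k j} \<subseteq> {..<m}"
        using card_mono[of "{..<m}" "{j. j < k \<and> \<not> e k j}"] * by auto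
      then obtain y where "y \<in> {j. j < k \<and> \<not> e k j}" "y \<notin> {..<m}"
        by blast
      then have y: "y < k" "\<not> e k y" "m \<le> y"
        by simp_all
      then have "e k m"
        using me by simp
      then show "\<exists>x y. x < y \<and> y < k \<and> e k x \<and> \<not> e k y"
        using y by (intro exI[of _ m] exI[of _ y]) (auto simp: le_less)
    next
      assume "\<exists>x y. x < y \<and> y < k \<and> e k x \<and> \<not> e k y"
      then obtain x y where *: "x < y" "y < k" "e k x" "\<not> e k y"
        by blast
      then have "m < y"
        using ml[of x] by simp
      moreover have "\<not> e k j" if "j < m" for j
        using ml[of j] that by auto
      ultimately have "insert y {..<m} \<subseteq> {j. j < k \<and> \<not> e k j}"
        using * by auto
      then have "card (insert y {..<m}) \<le> card {j. j < k \<and> \<not> e k j}"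
        by (intro card_mono) auto
      then show "m < card {j. j < k \<and> \<not> e k j}"
        using \<open>m < y\<close> by simp
    qed
    then show ?thesis
      using MF by (simp add: pair_test_def r m_def)
  qed
  then show ?thesis
    unfolding e_commute[of k] .
qed

definition occurs :: "status \<Rightarrow> status \<Rightarrow> status \<Rightarrow> bool" where
  "occurs a b c \<longleftrightarrow> (\<exists>x y z. x < y \<and> y < z \<and> z < n \<and>
     meets a (e x y) \<and> meets b (e y z) \<and> meets c (e x z))"

text \<open>The two decided pairs meet in the middle vertex, and the conditions on its two sides are
  independent of each other.\<close>

lemma middle_search_runs:
  assumes "ready s" "regs s 12 = 0" "regs s 13 = 0"
  shows "runs W (star_search (left_test a) (right_test b)) s
    (\<lambda>t s'. t \<le> 15 * offset adj n + 30 * n + 2 \<and> regs s' 13 = of_bool (occurs a b Undecided))"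
proof -
  have "occurs a b Undecided \<longleftrightarrow>
      (\<exists>k<n. (\<exists>x<k. meets a (e x k)) \<and> (\<exists>z. k < z \<and> z < n \<and> meets b (e k z)))"
    unfolding occurs_def by (auto intro: less_trans)
  then show ?thesis
    using star_search_runs[OF assms, of "left_test a" "right_test b"
        "\<lambda>k. (\<exists>x<k. meets a (e x k)) \<and> (\<exists>z. k < z \<and> z < n \<and> meets b (e k z))"]
      left_test_holds right_test_holds by simp
qed

text \<open>The decided pairs meet in the last vertex. Both partners then lie on the same side and
  must also be in the right order, which is the task of \<open>pair_test\<close>.\<close>

lemma end_search_runs:
  assumes "ready s" "regs s 12 = 0" "regs s 13 = 0"
  shows "runs W (star_search (pair_test c b) always) s
    (\<lambda>t s'. t \<le> 15 * offset adj n + 30 * n + 2 \<and>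
      regs s' 13 = of_bool (occurs Undecided b (if c then Mandatory else Forbidden)))"
proof -
  have "occurs Undecided b (if c then Mandatory else Forbidden) \<longleftrightarrow>
      (\<exists>k<n. \<exists>x y. x < y \<and> y < k \<and> e x k = c \<and> meets b (e y k))"
    unfolding occurs_def by (cases c) auto
  then show ?thesis
    using star_search_runs[OF assms, of "pair_test c b" always
        "\<lambda>k. \<exists>x y. x < y \<and> y < k \<and> e x k = c \<and> meets b (e y k)"]
      pair_test_holds by (simp add: always_def)
qed

lemma occurs_elimination:
  "(\<exists>k<n. \<exists>i<n. partner True i = Suc k \<and> bad True k i) \<longleftrightarrow> occurs Forbidden Mandatory Mandatory"
  "(\<exists>k<n. \<exists>i<n. partner False i = Suc k \<and> bad False k i) \<longleftrightarrow> occurs Mandatory Forbidden Forbidden"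
  unfolding elimination_test_correct occurs_def by auto

end

section \<open>Inputs and patterns\<close>

definition rank_step :: "bool \<Rightarrow> program" where
  "rank_step mirror =
     Load 4 0 (Reg 1) ;; Move 5 (Reg 1) ;;
     (if mirror then Sub 5 (Reg 0) (Reg 1) ;; Sub 5 (Reg 5) (Const 1) else Skip) ;;
     Store 3 (Reg 4) (Reg 5) ;; Add 1 (Reg 1) (Const 1)"

definition rank :: "bool \<Rightarrow> program" where
  "rank mirror = While (Less (Reg 1) (Reg 0)) (rank_step mirror)"

definition flip :: "bool \<Rightarrow> nat \<Rightarrow> nat \<Rightarrow> nat" where
  "flip mirror n i = (if mirror then n - i - 1 else i)"

lemma flip_less: "i < n \<Longrightarrow> flip mirror n i < n"
  by (simp add: flip_def)

lemma flip_flip: "i < n \<Longrightarrow> flip mirror n (flip mirror n i) = i"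
  by (simp add: flip_def)

lemma length_concat_take: "v \<le> length adj \<Longrightarrow> length (concat (take v adj)) = offset adj v"
proof (induction v)
  case (Suc v)
  then show ?case
    by (simp add: take_Suc_conv_app_nth offset_def)
qed (simp add: offset_def)

lemma nth_concat_offset:
  assumes "v < length adj" "j < length (adj ! v)"
  shows "offset adj v + j < length (concat adj)" "concat adj ! (offset adj v + j) = adj ! v ! j"
proof -
  have "concat adj = concat (take v adj @ adj ! v # drop (Suc v) adj)"
    using id_take_nth_drop[OF assms(1)] by simp
  then have *: "concat adj = concat (take v adj) @ adj ! v @ concat (drop (Suc v) adj)"
    by simp
  have l: "length (concat (take v adj)) = offset adj v"
    using assms by (intro length_concat_take) simp
  show "offset adj v + j < length (concat adj)" "concat adj ! (offset adj v + j) = adj ! v ! j"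
    unfolding * using assms l by (simp_all add: nth_append)
qed

context adjacency_lists begin

lemma rank_runs:
  assumes vs: "length vs = n" "set vs = {..<n}"
    and p: "\<And>i. i < n \<Longrightarrow> p (vs ! i) = flip mirror n i"
  shows "runs W (rank mirror) (input_state vs adj) (\<lambda>t s. t \<le> 8 * n + 1 \<and>
    ready s \<and> regs s 12 = 0 \<and> regs s 13 = 0 \<and> arrs s 5 = (\<lambda>_. 0))"
proof -
  let ?s0 = "input_state vs adj"
  define I where "I k s \<longleftrightarrow> (\<forall>x. x \<noteq> 1 \<and> x \<noteq> 4 \<and> x \<noteq> 5 \<longrightarrow> regs s x = regs ?s0 x) \<and> regs s 1 = k \<and>
    (\<forall>a. a \<noteq> 3 \<longrightarrow> arrs s a = arrs ?s0 a) \<and> (\<forall>i<k. arrs s 3 (vs ! i) = p (vs ! i))" for k and s :: state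
  have init: "regs ?s0 0 = n" "arrs ?s0 0 = array_of vs"
    by (simp_all add: input_state_def)
  have loop: "runs W (rank mirror) ?s0 (\<lambda>t s. t \<le> (\<Sum>k<n. 7 + 1) + 1 \<and> I n s)"
    unfolding rank_def
  proof (rule runs_for[where I = I])
    show "I 0 ?s0"
      by (simp add: I_def input_state_def)
  next
    fix k s assume "I k s"
    then show "holds s (Less (Reg 1) (Reg 0)) \<longleftrightarrow> k < n"
      by (simp add: I_def init)
  next
    fix k s assume I: "I k s" and k: "k < n"
    have r: "regs s (Suc 0) = k" "regs s 0 = n" "arrs s 0 k = vs ! k"
      using I k vs(1) by (simp_all add: I_def init array_of_def)
    have W: "vs ! k \<le> W" "Suc k \<le> W" "n - k \<le> W" "n - Suc k \<le> W" "k \<le> W"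
      using words k vs nth_mem[of k vs] by auto
    define s' where "s' = set_reg 1 (Suc k) (set_arr 3 (vs ! k) (flip mirror n k)
      (set_reg 5 (flip mirror n k) (set_reg 4 (vs ! k) s)))"
    have I': "I (Suc k) s'"
      using I p[OF k] by (auto simp: I_def s'_def less_Suc_eq)
    have upd: "set_reg 5 u (set_reg 5 v s) = set_reg 5 u s" for u v s
      by (simp add: set_reg_def)
    show "runs W (rank_step mirror) s (\<lambda>t s'. t \<le> 7 \<and> I (Suc k) s')"
      using I' W r by (cases mirror) (simp_all add: rank_step_def s'_def flip_def upd)
  qed
  have final: "ready s \<and> regs s 12 = 0 \<and> regs s 13 = 0 \<and> arrs s 5 = (\<lambda>_. 0)" if "I n s" for s
  proof -
    have a: "regs s 0 = n" "regs s 12 = 0" "regs s 13 = 0" "arrs s 5 = (\<lambda>_. 0)" "arrs s 4 = (\<lambda>_. 0)"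
      "arrs s 1 = array_of (map (offset adj) [0..<n + 1])" "arrs s 2 = array_of (concat adj)"
      using that unfolding I_def by - (elim conjE, simp add: input_state_def)+
    have "arrs s 3 v = p v" if "v < n" for v
    proof -
      obtain i where "i < n" "vs ! i = v"
        using vs \<open>v < n\<close> by (metis in_set_conv_nth lessThan_iff)
      then show ?thesis
        using \<open>I n s\<close> by (auto simp: I_def)
    qed
    moreover have "arrs s 1 v = offset adj v" if "v \<le> n" for v
      using that unfolding a(6) by (auto simp: array_of_def simp del: upt_Suc)
    moreover have "arrs s 2 (offset adj v + j) = adj ! v ! j" if "v < n" "j < deg v" for v j
      using nth_concat_offset[OF that] unfolding a(7) by (simp add: array_of_def)
    ultimately show ?thesis
      using a by (simp add: ready_def mem_def)
  qed
  show ?thesis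
    by (rule runs_mono[OF loop]) (use final in auto)
qed

end

section \<open>From ordered graphs to triples of positions\<close>

definition detect :: "bool \<Rightarrow> program \<Rightarrow> program" where
  "detect mirror c = rank mirror ;; c ;; Move 0 (Reg 13)"

text \<open>The handshake lemma, by double counting of incidences; it turns bounds in terms of
  \<open>offset\<close> into bounds by the number of edges.\<close>

lemma sum_degrees:
  assumes "is_ordered_graph G" "represents vs adj G"
  shows "offset adj (length adj) = 2 * card (edges G)"
proof -
  let ?n = "length adj"
  have fin: "finite (edges G)" and V: "verts G = {..<?n}" and E: "edges G \<subseteq> all_pairs (verts G)"
    using assms finite_subset[of "edges G" "Pow (verts G)"]
    by (auto simp: is_ordered_graph_def represents_def all_pairs_def)
  have "length (adj ! v) = card {e \<in> edges G. v \<in> e}" if "v < ?n" for v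
  proof -
    have "length (adj ! v) = card {u. {v, u} \<in> edges G}"
      using assms(2) that unfolding represents_def by (metis distinct_card)
    also have "\<dots> = card ((\<lambda>u. {v, u}) ` {u. {v, u} \<in> edges G})"
      by (rule card_image[symmetric]) (auto simp: inj_on_def doubleton_eq_iff)
    also have "(\<lambda>u. {v, u}) ` {u. {v, u} \<in> edges G} = {e \<in> edges G. v \<in> e}"
    proof (intro set_eqI iffI)
      fix e assume e: "e \<in> {e \<in> edges G. v \<in> e}"
      then have "card e = 2" "v \<in> e"
        using E by (auto simp: all_pairs_def)
      then obtain u where "e = {v, u}"
        by (auto simp: card_2_iff)
      then show "e \<in> (\<lambda>u. {v, u}) ` {u. {v, u} \<in> edges G}"
        using e by auto
    qed auto
    finally show ?thesis .
  qed
  then have "offset adj ?n = (\<Sum>v<?n. card {e \<in> edges G. v \<in> e})"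
    by (simp add: offset_def)
  also have "\<dots> = (\<Sum>v<?n. \<Sum>e\<in>edges G. if v \<in> e then 1 else 0)"
    using fin by (intro sum.cong) (auto simp: sum.If_cases Int_def)
  also have "\<dots> = (\<Sum>e\<in>edges G. \<Sum>v<?n. if v \<in> e then 1 else 0)"
    by (rule sum.swap)
  also have "\<dots> = (\<Sum>e\<in>edges G. 2)"
  proof (rule sum.cong)
    fix e assume "e \<in> edges G"
    then have "e \<subseteq> {..<?n}" "card e = 2"
      using E V by (auto simp: all_pairs_def)
    then show "(\<Sum>v<?n. if v \<in> e then 1 else 0) = (2::nat)"
      by (simp add: sum.If_cases Int_absorb1)
  qed simp
  finally show ?thesis
    by simp
qed

text \<open>Here indices refer to the given order of \<open>vs\<close>, whereas
  \<open>occurs\<close> speaks of positions, which may be mirrored.\<close>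

definition occurs_in :: "nat ordered_graph \<Rightarrow> nat list \<Rightarrow> status \<Rightarrow> status \<Rightarrow> status \<Rightarrow> bool" where
  "occurs_in G vs a b c \<longleftrightarrow> (\<exists>i j k. i < j \<and> j < k \<and> k < length vs \<and>
     meets a ({vs ! i, vs ! j} \<in> edges G) \<and> meets b ({vs ! j, vs ! k} \<in> edges G) \<and>
     meets c ({vs ! i, vs ! k} \<in> edges G))"

text \<open>Reversal is an involution on the positions and turns an increasing triple around, hence
  the exchanged first and last arguments.\<close>

lemma ex_flip_triple:
  "(\<exists>x y z. x < y \<and> y < z \<and> z < n \<and> Q x y z) \<longleftrightarrow>
   (\<exists>i j k. i < j \<and> j < k \<and> k < n \<and> (if mirror then Q (flip mirror n k) (flip mirror n j) (flip mirror n i)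
      else Q (flip mirror n i) (flip mirror n j) (flip mirror n k)))" for n :: nat
proof (cases mirror)
  case True
  show ?thesis
  proof
    assume "\<exists>x y z. x < y \<and> y < z \<and> z < n \<and> Q x y z"
    then obtain x y z where *: "x < y" "y < z" "z < n" "Q x y z"
      by blast
    have "n - z - 1 < n - y - 1" "n - y - 1 < n - x - 1" "n - x - 1 < n"
      "n - (n - z - 1) - 1 = z" "n - (n - y - 1) - 1 = y" "n - (n - x - 1) - 1 = x"
      using * by auto
    then show "\<exists>i j k. i < j \<and> j < k \<and> k < n \<and>
      (if mirror then Q (flip mirror n k) (flip mirror n j) (flip mirror n i)
       else Q (flip mirror n i) (flip mirror n j) (flip mirror n k))"
      using *(4) True
      by (intro exI[of _ "n - z - 1"] exI[of _ "n - y - 1"] exI[of _ "n - x - 1"]) (simp only: flip_def if_True)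
  next
    assume "\<exists>i j k. i < j \<and> j < k \<and> k < n \<and>
      (if mirror then Q (flip mirror n k) (flip mirror n j) (flip mirror n i)
       else Q (flip mirror n i) (flip mirror n j) (flip mirror n k))"
    then obtain i j k where *: "i < j" "j < k" "k < n" "Q (n - k - 1) (n - j - 1) (n - i - 1)"
      unfolding flip_def using True by auto
    then have "n - k - 1 < n - j - 1" "n - j - 1 < n - i - 1" "n - i - 1 < n"
      by auto
    then show "\<exists>x y z. x < y \<and> y < z \<and> z < n \<and> Q x y z"
      using *(4) by blast
  qed
qed (simp add: flip_def)

text \<open>The premise \<open>search\<close> ranges over all position functions and word sizes
  because these depend on the input, while the program \<open>d\<close> is fixed. Mirroring
  exchanges the statuses of the pairs (1, 2) and (2, 3).\<close>

lemma detect_runs: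
  assumes G: "is_ordered_graph G" "represents vs adj G"
    and search: "\<And>p W s. adjacency_lists adj p W \<Longrightarrow> adjacency_lists.ready adj p s \<Longrightarrow> regs s 12 = 0 \<Longrightarrow>
      regs s 13 = 0 \<Longrightarrow> arrs s 5 = (\<lambda>_. 0) \<Longrightarrow>
      runs W d s (\<lambda>t s'. t \<le> 43 * offset adj (length adj) + 60 * length adj + 4 \<and>
        regs s' 13 = of_bool (adjacency_lists.occurs adj p a b c))"
  shows "\<exists>t s. exec ((card (verts G) + card (edges G) + 2) ^ 2) (detect mirror d) (input_state vs adj) t s \<and>
    t \<le> 100 * (card (verts G) + card (edges G) + 1) \<and>
    regs s 0 = (if occurs_in G vs (if mirror then b else a) (if mirror then a else b) c then 1 else 0)"
proof -
  define n m W where "n = length adj" and "m = card (edges G)" and "W = (n + m + 2) ^ 2"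
  have V: "verts G = {..<n}" and E: "edges G \<subseteq> all_pairs (verts G)"
    and adj: "\<And>v. v < n \<Longrightarrow> distinct (adj ! v) \<and> set (adj ! v) = {u. {v, u} \<in> edges G}"
    and vs: "distinct vs" "set vs = {..<n}"
    using G by (auto simp: n_def represents_def is_ordered_graph_def)
  have len: "length vs = n"
    using vs by (metis card_lessThan distinct_card)
  have off: "offset adj n = 2 * m"
    unfolding n_def m_def by (rule sum_degrees[OF G])
  define p where "p v = flip mirror n (inv_into {..<n} ((!) vs) v)" for v
  have nth_bij: "bij_betw ((!) vs) {..<n} {..<n}"
    by (rule bij_betw_nth) (simp_all add: vs len)
  have p: "p (vs ! i) = flip mirror n i" if "i < n" for i
    unfolding p_def using nth_bij that by (simp add: bij_betw_def inv_into_f_f)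
  have flip_bij: "bij_betw (flip mirror n) {..<n} {..<n}"
    by (rule bij_betw_byWitness[where f' = "flip mirror n"]) (auto simp: flip_flip flip_less)
  have "bij_betw (flip mirror n \<circ> inv_into {..<n} ((!) vs)) {..<n} {..<n}"
    by (rule bij_betw_trans[OF bij_betw_inv_into[OF nth_bij] flip_bij])
  moreover have "flip mirror n \<circ> inv_into {..<n} ((!) vs) = p"
    by (auto simp: p_def)
  ultimately have bij: "bij_betw p {..<n} {..<n}"
    by simp
  have nbr: "u < n \<and> {u, v} \<in> edges G \<and> u \<noteq> v" if "{v, u} \<in> edges G" for u v
  proof -
    have "{v, u} \<subseteq> {..<n}" "card {v, u} = 2"
      using that E V by (auto simp: all_pairs_def)
    then show ?thesis
      using that by (auto simp: insert_commute)
  qed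
  \<comment> \<open>The term \<open>2 * m\<close> is the total length of the adjacency lists; the
    exponent 2 gives enough room for \<open>words\<close>.\<close>
  have "2 * m + 2 * n + 2 \<le> W"
    by (simp add: W_def power2_eq_square algebra_simps)
  then interpret adjacency_lists adj p W
    using bij adj nbr off by unfold_locales (auto simp: n_def[symmetric])
  have e: "e (p u) (p v) \<longleftrightarrow> {u, v} \<in> edges G" if "u < n" "v < n" for u v
  proof -
    have "e (p u) (p v) \<longleftrightarrow> v \<in> set (adj ! u)"
      using that nbr p_eq adj unfolding n_def by (subst e_p) auto
    then show ?thesis
      using adj[OF that(1)] by simp
  qed
  have vsn: "vs ! i < n" if "i < n" for i
    using vs(2) len that nth_mem by fastforce
  have e': "e (flip mirror n i) (flip mirror n j) \<longleftrightarrow> {vs ! i, vs ! j} \<in> edges G" if "i < n" "j < n" for i j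
    using e[OF vsn vsn] p that by metis
  have occ: "occurs a b c \<longleftrightarrow> occurs_in G vs (if mirror then b else a) (if mirror then a else b) c"
    unfolding occurs_def occurs_in_def len n_def[symmetric]
    by (subst ex_flip_triple[where mirror = mirror])
       (intro ex_cong1 conj_cong refl, use e' in \<open>auto simp: insert_commute\<close>)
  have rank: "runs W (rank mirror) (input_state vs adj) (\<lambda>t s. t \<le> 8 * n + 1 \<and>
      (ready s \<and> regs s 12 = 0 \<and> regs s 13 = 0 \<and> arrs s 5 = (\<lambda>_. 0)))"
    using rank_runs[of vs mirror] len vs p unfolding n_def by blast
  have fin: "runs W (d ;; Move 0 (Reg 13)) s (\<lambda>t s. t \<le> (86 * m + 60 * n + 4) + 1 \<and>
      regs s 0 = of_bool (occurs a b c))"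
    if s: "ready s \<and> regs s 12 = 0 \<and> regs s 13 = 0 \<and> arrs s 5 = (\<lambda>_. 0)" for s
  proof (rule runs_SeqI)
    show "runs W d s (\<lambda>t s'. t \<le> 86 * m + 60 * n + 4 \<and> regs s' 13 = of_bool (occurs a b c))"
      by (rule runs_mono[OF search[OF adjacency_lists_axioms]]) (use s off n_def in auto)
  next
    fix s' :: state assume "regs s' 13 = of_bool (occurs a b c)"
    then show "runs W (Move 0 (Reg 13)) s' (\<lambda>t s. t \<le> 1 \<and> regs s 0 = of_bool (occurs a b c))"
      using words by (auto simp: of_bool_def)
  qed simp
  have "runs W (detect mirror d) (input_state vs adj) (\<lambda>t s. t \<le> 100 * (n + m + 1) \<and>
      regs s 0 = of_bool (occurs a b c))"
    \<comment> \<open>Here \<open>43 * offset adj n\<close> has become \<open>86 * m\<close>; with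
      ranking and copying the answer, the total is at most
      \<open>68 * n + 86 * m + 6\<close>.\<close>
    unfolding detect_def by (rule runs_SeqI[OF rank fin]) auto
  then show ?thesis
    unfolding runs_def occ V W_def m_def by (simp add: of_bool_def)
qed

text \<open>One program \<open>d\<close> must serve all inputs, hence the order of the quantifiers.
  The time bound is that of \<open>elimination_test\<close>, which also covers
  \<open>star_search\<close>.\<close>

definition searchable :: "status \<Rightarrow> status \<Rightarrow> status \<Rightarrow> bool" where
  "searchable a b c \<longleftrightarrow> (\<exists>d. \<forall>adj p W s. adjacency_lists adj p W \<longrightarrow> adjacency_lists.ready adj p s \<longrightarrow>
     regs s 12 = 0 \<longrightarrow> regs s 13 = 0 \<longrightarrow> arrs s 5 = (\<lambda>_. 0) \<longrightarrow>
     runs W d s (\<lambda>t s'. t \<le> 43 * offset adj (length adj) + 60 * length adj + 4 \<and>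
        regs s' 13 = of_bool (adjacency_lists.occurs adj p a b c)))"

lemma searchable_middle: "searchable a b Undecided"
  unfolding searchable_def
  by (intro exI[of _ "star_search (left_test a) (right_test b)"] allI impI
      runs_mono[OF adjacency_lists.middle_search_runs]) auto

lemma searchable_end: "searchable Undecided b (if c then Mandatory else Forbidden)"
  unfolding searchable_def
  by (intro exI[of _ "star_search (pair_test c b) always"] allI impI
      runs_mono[OF adjacency_lists.end_search_runs]) auto

lemma searchable_elimination:
  "searchable Forbidden Mandatory Mandatory" "searchable Mandatory Forbidden Forbidden"
proof -
  show "searchable Forbidden Mandatory Mandatory"
    unfolding searchable_def adjacency_lists.occurs_elimination[symmetric]
    by (intro exI[of _ "elimination_test True"] allI impI)
      (subst adjacency_lists.occurs_elimination[symmetric], assumption,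
        rule adjacency_lists.elimination_test_runs)
  show "searchable Mandatory Forbidden Forbidden"
    unfolding searchable_def
    by (intro exI[of _ "elimination_test False"] allI impI)
      (subst adjacency_lists.occurs_elimination[symmetric], assumption,
        rule adjacency_lists.elimination_test_runs)
qed

text \<open>The second disjunct is the mirror image. An undecided \<open>c\<close> is handled in the
  middle, an undecided \<open>a\<close> or \<open>b\<close> at an end. With all three decided, what
  remains is the two elimination triples and their mirror images.\<close>

lemma searchable_cases:
  assumes "(a, b, c) \<notin> {(Mandatory, Mandatory, Mandatory), (Mandatory, Mandatory, Forbidden),
    (Forbidden, Forbidden, Forbidden), (Forbidden, Forbidden, Mandatory)}"
  shows "searchable a b c \<or> searchable b a c"
  using assms searchable_middle[of a b] searchable_elimination
    searchable_end[of b True] searchable_end[of b False] searchable_end[of a True] searchable_end[of a False]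
  by (cases a; cases b; cases c) simp_all

section \<open>Three-vertex patterns as triples of statuses\<close>

definition edge_status :: "'p pattern \<Rightarrow> 'p set \<Rightarrow> status" where
  "edge_status P e = (if e \<in> mandatory P then Mandatory else if e \<in> forbidden P then Forbidden else Undecided)"

lemma partition_by_status:
  assumes "mandatory P \<inter> forbidden P = {}" "mandatory P \<inter> undecided P = {}"
    "forbidden P \<inter> undecided P = {}"
  shows "mandatory P = {e \<in> mandatory P \<union> forbidden P \<union> undecided P. edge_status P e = Mandatory}"
    and "forbidden P = {e \<in> mandatory P \<union> forbidden P \<union> undecided P. edge_status P e = Forbidden}"
    and "undecided P = {e \<in> mandatory P \<union> forbidden P \<union> undecided P. edge_status P e = Undecided}"
  using assms by (auto simp: edge_status_def)

lemma all_pairs_three: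
  assumes "distinct [x, y, z]"
  shows "all_pairs {x, y, z} = {{x, y}, {y, z}, {x, z}}"
proof (intro set_eqI iffI)
  fix e assume "e \<in> all_pairs {x, y, z}"
  then obtain u v where "e = {u, v}" "u \<noteq> v" "u \<in> {x, y, z}" "v \<in> {x, y, z}"
    by (auto simp: all_pairs_def card_2_iff)
  then show "e \<in> {{x, y}, {y, z}, {x, z}}"
    by (auto simp: insert_commute)
qed (use assms in \<open>auto simp: all_pairs_def\<close>)

lemma linear_order_three:
  assumes r: "linear_order_on V r" and "card V = 3"
  obtains x y z where "distinct [x, y, z]" "V = {x, y, z}" "(x, y) \<in> r" "(y, z) \<in> r" "(x, z) \<in> r"
proof -
  obtain u v w where V: "V = {u, v, w}" "u \<noteq> v" "v \<noteq> w" "u \<noteq> w"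
    using \<open>card V = 3\<close> by (auto simp: card_3_iff)
  have t: "trans r"
    using r by (auto simp: order_on_defs)
  have tot: "(a, b) \<in> r \<or> (b, a) \<in> r" if "a \<in> V" "b \<in> V" "a \<noteq> b" for a b
    using r that by (auto simp: order_on_defs total_on_def)
  have "(u, v) \<in> r \<or> (v, u) \<in> r" "(v, w) \<in> r \<or> (w, v) \<in> r" "(u, w) \<in> r \<or> (w, u) \<in> r"
    using tot V by auto
  moreover have "{u, w, v} = V" "{v, u, w} = V" "{v, w, u} = V" "{w, u, v} = V" "{w, v, u} = V"
    using V by auto
  ultimately show thesis
    using that[of u v w] that[of u w v] that[of v u w] that[of v w u] that[of w u v] that[of w v u] V
      transD[OF t] by (smt (verit) distinct_length_2_or_more distinct_singleton)
qed

locale three_vertex_pattern =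
  fixes P :: "'p pattern" and x y z :: 'p
  assumes pattern: "is_pattern P"
    and dist: "distinct [x, y, z]" and verts: "pverts P = {x, y, z}"
    and ord: "(x, y) \<in> pord P" "(y, z) \<in> pord P" "(x, z) \<in> pord P"
begin

lemma ord_iff:
  assumes "u \<in> {x, y, z}" "v \<in> {x, y, z}"
  shows "(u, v) \<in> pord P \<longleftrightarrow> u = v \<or> (u = x \<and> v \<noteq> x) \<or> (u = y \<and> v = z)"
proof -
  have "refl_on {x, y, z} (pord P)" "antisym (pord P)"
    using pattern verts by (auto simp: is_pattern_def order_on_defs)
  then show ?thesis
    using assms ord dist by (auto dest: refl_onD antisymD)
qed

lemma pairs: "mandatory P \<union> forbidden P \<union> undecided P = {{x, y}, {y, z}, {x, z}}"
  using pattern unfolding is_pattern_def verts all_pairs_three[OF dist] by (elim conjE)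

lemma disjoint: "mandatory P \<inter> forbidden P = {}" "mandatory P \<inter> undecided P = {}"
    "forbidden P \<inter> undecided P = {}"
  using pattern by (simp_all add: is_pattern_def)

lemma meets_edge_status:
  "(\<forall>e\<in>mandatory P. f ` e \<in> E) \<and> (\<forall>e\<in>forbidden P. f ` e \<notin> E) \<longleftrightarrow>
   meets (edge_status P {x, y}) ({f x, f y} \<in> E) \<and> meets (edge_status P {y, z}) ({f y, f z} \<in> E) \<and>
   meets (edge_status P {x, z}) ({f x, f z} \<in> E)"
proof -
  have "(\<forall>e\<in>mandatory P. f ` e \<in> E) \<and> (\<forall>e\<in>forbidden P. f ` e \<notin> E) \<longleftrightarrow>
      (\<forall>e \<in> mandatory P \<union> forbidden P \<union> undecided P. meets (edge_status P e) (f ` e \<in> E))"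
    using pattern by (auto simp: is_pattern_def edge_status_def)
  then show ?thesis
    unfolding pairs by simp
qed

text \<open>As \<open>vs\<close> is sorted and the order antisymmetric, an order-preserving map has
  increasing indices; conversely, three increasing indices define such a map.\<close>

lemma contains_iff:
  assumes G: "is_ordered_graph G" "represents vs adj G"
  shows "contains G P \<longleftrightarrow>
    occurs_in G vs (edge_status P {x, y}) (edge_status P {y, z}) (edge_status P {x, z})"
proof
  have vs: "distinct vs" "set vs = verts G" "sorted_wrt (\<lambda>u v. (u, v) \<in> vord G) vs"
    using G by (auto simp: represents_def)
  have as: "antisym (vord G)" "refl_on (verts G) (vord G)"
    using G by (auto simp: is_ordered_graph_def order_on_defs)
  have mono: "i < j" if "i < length vs" "j < length vs" "(vs ! i, vs ! j) \<in> vord G" "vs ! i \<noteq> vs ! j" for i j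
  proof (rule ccontr)
    assume "\<not> i < j"
    then have "j < i"
      using that by (metis linorder_neqE_nat)
    then have "(vs ! j, vs ! i) \<in> vord G"
      using vs(3) that by (simp add: sorted_wrt_iff_nth_less)
    then show False
      using as that by (auto dest: antisymD)
  qed
  {
    assume "contains G P"
    then obtain X f where X: "X \<subseteq> verts G" "order_bij f (pverts P) (pord P) X (vord G)"
      and f: "(\<forall>e\<in>mandatory P. f ` e \<in> edges G) \<and> (\<forall>e\<in>forbidden P. f ` e \<notin> edges G)"
      by (auto simp: contains_def)
    then have inj: "inj_on f {x, y, z}" and im: "f ` {x, y, z} \<subseteq> verts G"
      and o: "(f x, f y) \<in> vord G" "(f y, f z) \<in> vord G"
      using ord by (auto simp: order_bij_def bij_betw_def verts)
    obtain i j k where *: "i < length vs" "j < length vs" "k < length vs"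
        "f x = vs ! i" "f y = vs ! j" "f z = vs ! k"
      using im vs(2) by (metis image_subset_iff in_set_conv_nth insertCI)
    have "i < j" "j < k"
      using mono[of i j] mono[of j k] * o inj dist by (auto simp: inj_on_def)
    then show "occurs_in G vs (edge_status P {x, y}) (edge_status P {y, z}) (edge_status P {x, z})"
      using f * unfolding occurs_in_def meets_edge_status by auto
  }
  assume "occurs_in G vs (edge_status P {x, y}) (edge_status P {y, z}) (edge_status P {x, z})"
  then obtain i j k where l: "i < j" "j < k" "k < length vs"
    and m: "meets (edge_status P {x, y}) ({vs ! i, vs ! j} \<in> edges G)"
      "meets (edge_status P {y, z}) ({vs ! j, vs ! k} \<in> edges G)"
      "meets (edge_status P {x, z}) ({vs ! i, vs ! k} \<in> edges G)"
    unfolding occurs_in_def by blast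
  define f where "f u = (if u = x then vs ! i else if u = y then vs ! j else vs ! k)" for u
  have f: "f x = vs ! i" "f y = vs ! j" "f z = vs ! k"
    using dist by (auto simp: f_def)
  have o: "(vs ! i, vs ! j) \<in> vord G" "(vs ! j, vs ! k) \<in> vord G" "(vs ! i, vs ! k) \<in> vord G"
    using vs(3) l by (simp_all add: sorted_wrt_iff_nth_less)
  have ne: "vs ! i \<noteq> vs ! j" "vs ! j \<noteq> vs ! k" "vs ! i \<noteq> vs ! k"
    using vs(1) l by (simp_all add: nth_eq_iff_index_eq)
  have mem: "vs ! i \<in> verts G" "vs ! j \<in> verts G" "vs ! k \<in> verts G"
    using l vs(2) by (metis less_trans nth_mem)+
  have inj: "inj_on f {x, y, z}"
    using ne by (auto simp: inj_on_def f)
  \<comment> \<open>The condition in \<open>order_bij\<close> is an equivalence, so the reversed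
    pairs have to be excluded as well.\<close>
  have rev: "(vs ! j, vs ! i) \<notin> vord G" "(vs ! k, vs ! j) \<notin> vord G" "(vs ! k, vs ! i) \<notin> vord G"
    using o ne as(1) by (auto dest: antisymD)
  have rfl: "(u, u) \<in> vord G" if "u \<in> verts G" for u
    using as(2) that by (rule refl_onD)
  have "\<forall>u\<in>{x, y, z}. \<forall>v\<in>{x, y, z}. (u, v) \<in> pord P \<longleftrightarrow> (f u, f v) \<in> vord G"
    using ord_iff dist o rev rfl mem by (auto simp: f)
  then have "order_bij f (pverts P) (pord P) (f ` {x, y, z}) (vord G)"
    unfolding order_bij_def verts using inj by (simp add: bij_betw_def)
  moreover have "card (f ` {x, y, z}) = card (pverts P)"
    unfolding verts by (rule card_image[OF inj])
  moreover have "f ` {x, y, z} \<subseteq> verts G"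
    using mem by (simp add: f)
  moreover have "(\<forall>e\<in>mandatory P. f ` e \<in> edges G) \<and> (\<forall>e\<in>forbidden P. f ` e \<notin> edges G)"
    unfolding meets_edge_status f using m by blast
  ultimately show "contains G P"
    unfolding contains_def by blast
qed

text \<open>A search for the mirror image suffices: \<open>detect\<close> then runs it on the
  reversed positions.\<close>

lemma searchable_imp_linear:
  assumes "searchable a b c"
    and "edge_status P {x, y} = (if mirror then b else a)" "edge_status P {y, z} = (if mirror then a else b)"
      "edge_status P {x, z} = c"
  shows "detection_in_linear_time P"
proof -
  obtain d where d: "\<And>adj p W s. adjacency_lists adj p W \<Longrightarrow> adjacency_lists.ready adj p s \<Longrightarrow>
     regs s 12 = 0 \<Longrightarrow> regs s 13 = 0 \<Longrightarrow> arrs s 5 = (\<lambda>_. 0) \<Longrightarrow>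
     runs W d s (\<lambda>t s'. t \<le> 43 * offset adj (length adj) + 60 * length adj + 4 \<and>
        regs s' 13 = of_bool (adjacency_lists.occurs adj p a b c))"
    using assms(1) unfolding searchable_def by blast
  have "\<exists>t s. exec ((card (verts G) + card (edges G) + 2) ^ 2) (detect mirror d) (input_state vs adj) t s \<and>
      t \<le> 100 * (card (verts G) + card (edges G) + 1) \<and> regs s 0 = (if contains G P then 1 else 0)"
    if G: "is_ordered_graph G" "represents vs adj G" for G vs adj
    unfolding contains_iff[OF G] assms(2-4) by (rule detect_runs[OF G d])
  then show ?thesis
    unfolding detection_in_linear_time_def Let_def by blast
qed

text \<open>The three parts of either pattern are the fibres of \<open>edge_status\<close> over its
  three pairs, so the order-preserving map carries parts to parts as soon as the statuses
  agree.\<close>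

lemma pattern_isoI:
  assumes Q: "pverts Q = {1, 2, 3 :: nat}" "pord Q = {(i, j). i \<in> {1, 2, 3} \<and> j \<in> {1, 2, 3} \<and> i \<le> j}"
      "mandatory Q \<union> forbidden Q \<union> undecided Q = {{1, 2}, {2, 3}, {1, 3}}"
      "mandatory Q \<inter> forbidden Q = {}" "mandatory Q \<inter> undecided Q = {}" "forbidden Q \<inter> undecided Q = {}"
    and st: "edge_status P {x, y} = edge_status Q {1, 2}" "edge_status P {y, z} = edge_status Q {2, 3}"
      "edge_status P {x, z} = edge_status Q {1, 3}"
  shows "pattern_iso P Q"
proof -
  define f :: "'p \<Rightarrow> nat" where "f u = (if u = x then 1 else if u = y then 2 else 3)" for u
  have f: "f x = 1" "f y = 2" "f z = 3"
    using dist by (auto simp: f_def)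
  have "order_bij f (pverts P) (pord P) (pverts Q) (pord Q)"
    unfolding order_bij_def verts Q(1,2)
    using ord_iff dist by (auto simp: bij_betw_def inj_on_def f)
  moreover have "(`) f ` {e \<in> {{x, y}, {y, z}, {x, z}}. edge_status P e = s} =
      {e \<in> {{1, 2}, {2, 3}, {1, 3}}. edge_status Q e = s}" for s
  proof -
    have "{e \<in> {{x, y}, {y, z}, {x, z}}. edge_status P e = s} =
        (if edge_status P {x, y} = s then {{x, y}} else {}) \<union>
        (if edge_status P {y, z} = s then {{y, z}} else {}) \<union>
        (if edge_status P {x, z} = s then {{x, z}} else {})"
      by auto
    moreover have "{e \<in> {{1, 2}, {2, 3}, {1, 3 :: nat}}. edge_status Q e = s} =
        (if edge_status Q {1, 2} = s then {{1, 2}} else {}) \<union>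
        (if edge_status Q {2, 3} = s then {{2, 3}} else {}) \<union>
        (if edge_status Q {1, 3} = s then {{1, 3}} else {})"
      by auto
    ultimately show ?thesis
      by (simp add: st image_Un f)
  qed
  moreover have "mandatory P = {e \<in> {{x, y}, {y, z}, {x, z}}. edge_status P e = Mandatory}"
    "forbidden P = {e \<in> {{x, y}, {y, z}, {x, z}}. edge_status P e = Forbidden}"
    "undecided P = {e \<in> {{x, y}, {y, z}, {x, z}}. edge_status P e = Undecided}"
    using partition_by_status[OF disjoint] unfolding pairs .
  moreover have "mandatory Q = {e \<in> {{1, 2}, {2, 3}, {1, 3}}. edge_status Q e = Mandatory}"
    "forbidden Q = {e \<in> {{1, 2}, {2, 3}, {1, 3}}. edge_status Q e = Forbidden}"
    "undecided Q = {e \<in> {{1, 2}, {2, 3}, {1, 3}}. edge_status Q e = Undecided}"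
    using partition_by_status[OF Q(4-6)] unfolding Q(3) .
  ultimately show ?thesis
    unfolding pattern_iso_def by (intro exI[of _ f] conjI) (simp_all only:)
qed

lemma excluded_patterns:
  assumes "edge_status P {x, y} = a" "edge_status P {y, z} = b" "edge_status P {x, z} = c"
  shows "(a, b, c) = (Mandatory, Mandatory, Mandatory) \<Longrightarrow> pattern_iso P Triangle"
    and "(a, b, c) = (Mandatory, Mandatory, Forbidden) \<Longrightarrow> pattern_iso P Comparability"
    and "(a, b, c) = (Forbidden, Forbidden, Forbidden) \<Longrightarrow> pattern_iso P (complement Triangle)"
    and "(a, b, c) = (Forbidden, Forbidden, Mandatory) \<Longrightarrow> pattern_iso P (complement Comparability)"
proof -
  have ne: "{1, 2} \<noteq> {2, 3 :: nat}" "{1, 2} \<noteq> {1, 3 :: nat}" "{2, 3} \<noteq> {1, 3 :: nat}"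
    by (auto simp: doubleton_eq_iff)
  note defs = Triangle_def Comparability_def complement_def edge_status_def
  show "(a, b, c) = (Mandatory, Mandatory, Mandatory) \<Longrightarrow> pattern_iso P Triangle"
    using assms ne by (intro pattern_isoI) (auto simp: defs)
  show "(a, b, c) = (Mandatory, Mandatory, Forbidden) \<Longrightarrow> pattern_iso P Comparability"
    using assms ne by (intro pattern_isoI) (auto simp: defs)
  show "(a, b, c) = (Forbidden, Forbidden, Forbidden) \<Longrightarrow> pattern_iso P (complement Triangle)"
    using assms ne by (intro pattern_isoI) (auto simp: defs)
  show "(a, b, c) = (Forbidden, Forbidden, Mandatory) \<Longrightarrow> pattern_iso P (complement Comparability)"
    using assms ne by (intro pattern_isoI) (auto simp: defs)
qed

end

theorem theorem1:
  fixes P :: "'p pattern"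
  assumes "is_pattern P"
    and "card (pverts P) = 3"
    and "\<not> pattern_iso P Triangle"
    and "\<not> pattern_iso P Comparability"
    and "\<not> pattern_iso P (complement Triangle)"
    and "\<not> pattern_iso P (complement Comparability)"
  shows "detection_in_linear_time P"
proof -
  have "linear_order_on (pverts P) (pord P)"
    using assms(1) by (simp add: is_pattern_def)
  then obtain x y z where xyz: "distinct [x, y, z]" "pverts P = {x, y, z}"
    "(x, y) \<in> pord P" "(y, z) \<in> pord P" "(x, z) \<in> pord P"
    using assms(2) by (rule linear_order_three)
  interpret three_vertex_pattern P x y z
    using assms(1) xyz by unfold_locales
  define a b c where "a = edge_status P {x, y}" and "b = edge_status P {y, z}" and "c = edge_status P {x, z}"
  \<comment> \<open>Each of the four triples left out in \<open>searchable_cases\<close> would make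
    \<open>P\<close> isomorphic to an excluded pattern.\<close>
  have "searchable a b c \<or> searchable b a c"
    using excluded_patterns[OF a_def[symmetric] b_def[symmetric] c_def[symmetric]] assms(3-6)
    by (intro searchable_cases) blast
  then show ?thesis
  proof
    assume "searchable a b c"
    then show ?thesis
      by (rule searchable_imp_linear[where mirror = False]) (simp_all add: a_def b_def c_def)
  next
    assume "searchable b a c"
    then show ?thesis
      by (rule searchable_imp_linear[where mirror = True]) (simp_all add: a_def b_def c_def)
  qed
qed

end
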